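(* Let $\mathbb{K}$ be a field of characteristic zero. There does not exist a universal $A_\infty$-isomorphism of strict $A_\infty$-algebras $$f:\big(S\mathfrak{g}\otimes \textstyle\bigwedge \mathfrak{g}^*,(d_{\mathfrak g},\tilde m_0)\big)\rightarrow \big(S\mathfrak{g}\otimes \bigwedge \mathfrak{g}^*,(d_{\mathfrak g},\tilde m_{\mathrm{Duf}})\big)$$ whose first component $f_1$ is the identity. Explicitly: there is no sequence $(\Gamma_n)_{n\ge 2}$, with $\Gamma_n$ a (possibly infinite) linear combination of graphs in $\mathsf{dgraphs}(n)$, homogeneous of degree $1-n$, such that for every finite dimensional Lie algebra $\mathfrak g$ over $\mathbb{K}$ the maps $f_1=\mathrm{id}$ and $f_n=B_{\Gamma_n}$ ($n\ge 2$) on $A=S\mathfrak g\otimes\bigwedge\mathfrak g^*$ are the components of an $A_\infty$-morphism from $(A,d_{\mathfrak g},\tilde m_0)$ to $(A,d_{\mathfrak g},\tilde m_{\mathrm{Duf}})$.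
   Context: **The algebras.** For a finite dimensional Lie algebra $\mathfrak g$ put $A=S\mathfrak g\otimes\bigwedge\mathfrak g^*=C(\mathfrak g,S\mathfrak g)$, graded by exterior degree, with the Chevalley–Eilenberg differential $d_{\mathfrak g}$ for the adjoint action on $S\mathfrak g$. Let $J(x)=\det\left(\frac{e^{\mathrm{ad}_x/2}-e^{-\mathrm{ad}_x/2}}{\mathrm{ad}_x}\right)$, a formal power series on $\mathfrak g$; $J^{1/2}$ is viewed as a constant-coefficient differential operator of infinite order on $S\mathfrak g$ (polynomials on $\mathfrak g^*$). Let $\mathrm{Sym}:S\mathfrak g\to U\mathfrak g$ be the symmetrization map, $\mathrm{Duf}=\mathrm{Sym}\circ J^{1/2}:S\mathfrak g\to U\mathfrak g$ (a linear isomorphism), $m_0$ the commutative product of $S\mathfrak g$, and $m_{\mathrm{Duf}}=\mathrm{Duf}^{-1}\circ m_{U\mathfrak g}\circ \mathrm{Duf}^{\otimes 2}$. Then $\tilde m_0=m_0\otimes m_{\wedge}$ and $\tilde m_{\mathrm{Duf}}=m_{\mathrm{Duf}}\otimes m_\wedge$ on $A$, where $m_\wedge$ is the product of $\bigwedge\mathfrak g^*$. **$A_\infty$-morphisms.** An $A_\infty$-algebra is a graded space $A$ with maps $m_n:A^{\otimes n}\to A$ of degree $2-n$ with $\sum_{r+s+t=n}(-1)^{r+st}m_{r+1+t}(1^{\otimes r}\otimes m_s\otimes 1^{\otimes t})=0$ for all $n\ge1$; it is strict if $m_n=0$ for $n\ge 3$ (here $m_1$ is the differential and $m_2$ the product).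 A morphism $(A,m)\to(B,l)$ is a family $f_n:A^{\otimes n}\to B$ ($n\ge 1$) of degree $1-n$ with, for all $n\ge 1$, $$\sum_{r+s+t=n}(-1)^{r+st}f_{r+1+t}(1^{\otimes r}\otimes m_s\otimes 1^{\otimes t})=\sum_{r,\ i_1+\dots+i_r=n}(-1)^{\sigma}\,l_r(f_{i_1}\otimes\cdots\otimes f_{i_r}),\quad \sigma=\sum_{k=1}^{r-1}(r-k)(i_k-1)$$ (Koszul sign rule). It is an isomorphism if $f_1$ is an isomorphism. **Graphs.** An admissible directed graph with $n$ external vertices is a finite directed graph with vertices labeled $1,\dots,n$ (external) and possibly further unlabeled (internal) vertices, with a linear order on the set of edges, such that: there are no double edges (two edges with the same source and same target; a pair of opposite edges is allowed) and no simple loops (edges from a vertex to itself); every internal vertex is at most trivalent, with at most one incoming and at most two outgoing edges; every internal vertex is connected by an (undirected) path to some external vertex. $\mathsf{dgr}(n)$ is the vector space spanned by such graphs modulo $\Gamma^\sigma=(-1)^{|\sigma|}\Gamma$, where $\Gamma^\sigma$ is $\Gamma$ with edge order changed by the permutation $\sigma$ of parity $|\sigma|$. The generalized IHX relations: take either an admissible graph and an internal vertex $v$ of it, or a finite directed graph with $n$ labeled external vertices, further unlabeled internal vertices and a linear order on its edges, with no double edges and no simple loops, every internal vertex of which is connected by an (undirected) path to some external vertex, and in which one internal vertex $v$ is four-valent with one incoming and three outgoing edges while every other internal vertex is at most trivalent with at most one incoming and at most two outgoing edges; replace $v$ by two internal vertices joined by a directed edge $e$ (placed last in the edge order), sum over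 all ways of reconnecting the edges previously adjacent to $v$ to the endpoints of $e$ that produce admissible graphs, and set this sum equal to $0$. $\mathsf{dgraphs}(n)$ is the quotient of $\mathsf{dgr}(n)$ by these relations. The degree is $|\Gamma|=2\,\#\{\text{internal vertices}\}-\#\{\text{edges}\}$. **The representation $B$.** Choose a basis $x_1,\dots,x_d$ of $\mathfrak g$ with structure constants $c_{ij}^k$; identify $A=\mathbb{K}[x_1,\dots,x_d,p^1,\dots,p^d]$ with $x_i$ of degree $0$ and $p^i$ (dual basis) of degree $1$ (graded commutative). Put $\pi=\sum c_{ij}^k x_kp^ip^j$ and $\tau=\sum_l\frac{\partial}{\partial p^l}\otimes\frac{\partial}{\partial x_l}:A^{\otimes 2}\to A^{\otimes2}$ (an odd operator). For an admissible graph $\Gamma$ with $n$ external and $m$ internal vertices (the latter labeled arbitrarily $\bar1,\dots,\bar m$), $B_\Gamma:A^{\otimes n}\to A$ is $$B_\Gamma(f_1\otimes\cdots\otimes f_n)=\mu\Big(\prod_{(i,j)\in E(\Gamma)}\tau_{ij}\,(\pi\otimes\cdots\otimes\pi\otimes f_1\otimes\cdots\otimes f_n)\Big),$$ where there are $m$ factors $\pi$ (at positions $\bar1,\dots,\bar m$), $\tau_{ij}$ is $\tau$ acting on the $i$-th and $j$-th factors, $(i,j)$ denotes an edge from $i$ to $j$, the operators are applied in the order of the edges (first edge first), and $\mu$ is the iterated product of $A$. This does not depend on the labeling or the choice of basis, vanishes on the generalized IHX relations, and extends to infinite sums of graphs of a fixed degree and fixed $n$ (only finitely many terms act non-trivially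 on given elements of $A$). A map $A^{\otimes n}\to A$ is called universal if it is of the form $B_\Gamma$ with $\Gamma\in\mathsf{dgraphs}(n)$ independent of $\mathfrak g$. *)

theory Defs
  imports
    "HOL-Library.Poly_Mapping"
    "HOL-Computational_Algebra.Formal_Power_Series"
    "HOL-Combinatorics.Permutations"
    "HOL-Algebra.QuotRing"
    "Jordan_Normal_Form.Determinant"
begin

section \<open>Strict \<open>A\<^sub>\<infinity>\<close>-algebras and \<open>A\<^sub>\<infinity>\<close>-morphisms\<close>

text \<open>
  A graded vector space is given by its scalar multiplication \<open>s\<close> and its homogeneous
  components \<open>G k\<close>.  A linear map \<open>A\<^sup>\<otimes>\<^sup>n \<rightarrow> B\<close> of degree \<open>p\<close> is represented by the corresponding
  multilinear map on lists of \<open>n\<close> homogeneous elements.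
\<close>

definition homogeneous_list :: "(int \<Rightarrow> 'a set) \<Rightarrow> int list \<Rightarrow> 'a list \<Rightarrow> bool" where
  "homogeneous_list G ks as \<longleftrightarrow> list_all2 (\<lambda>k a. a \<in> G k) ks as"

definition graded_multilinear ::
  "('k::field \<Rightarrow> 'a::ab_group_add \<Rightarrow> 'a) \<Rightarrow> (int \<Rightarrow> 'a set) \<Rightarrow>
   ('k \<Rightarrow> 'b::ab_group_add \<Rightarrow> 'b) \<Rightarrow> (int \<Rightarrow> 'b set) \<Rightarrow> nat \<Rightarrow> int \<Rightarrow> ('a list \<Rightarrow> 'b) \<Rightarrow> bool" where
  "graded_multilinear sA GA sB GB n p f \<longleftrightarrow>
     (\<forall>ks as. length as = n \<and> homogeneous_list GA ks as \<longrightarrow>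
        f as \<in> GB (sum_list ks + p) \<and>
        (\<forall>i<n. \<forall>b\<in>GA (ks ! i). \<forall>u v.
           f (as[i := sA u (as ! i) + sA v b]) = sB u (f as) + sB v (f (as[i := b]))))"

text \<open>
  The sum of \<open>(-1)\<^sup>r\<^sup>+\<^sup>s\<^sup>t f\<^sub>r\<^sub>+\<^sub>1\<^sub>+\<^sub>t (1\<^sup>\<otimes>\<^sup>r \<otimes> m\<^sub>s \<otimes> 1\<^sup>\<otimes>\<^sup>t)\<close> over \<open>r + s + t = n\<close>, evaluated on homogeneous elements
  \<open>as\<close> of degrees \<open>ks\<close>.  The second sign is the Koszul sign for moving \<open>m\<^sub>s\<close>, of degree
  \<open>2 - s\<close>, past the first \<open>r\<close> arguments.
\<close>

definition ainf_lhs ::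
  "('k::field \<Rightarrow> 'b::ab_group_add \<Rightarrow> 'b) \<Rightarrow> (nat \<Rightarrow> 'a list \<Rightarrow> 'a) \<Rightarrow> (nat \<Rightarrow> 'a list \<Rightarrow> 'b) \<Rightarrow>
   int list \<Rightarrow> 'a list \<Rightarrow> 'b" where
  "ainf_lhs sB m f ks as =
     (\<Sum>(r, s, t)\<in>{(r, s, t). r + s + t = length as \<and> 1 \<le> s}.
        sB ((-1) ^ (r + s * t) * (-1) powi ((2 - int s) * sum_list (take r ks)))
           (f (r + 1 + t) (take r as @ [m s (take s (drop r as))] @ drop (r + s) as)))"

definition compositions :: "nat \<Rightarrow> nat list set" where
  "compositions n = {js. sum_list js = n \<and> 0 \<notin> set js}"

definition block :: "nat list \<Rightarrow> nat \<Rightarrow> 'a list \<Rightarrow> 'a list" where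
  "block js q as = take (js ! q) (drop (sum_list (take q js)) as)"

text \<open>
  The sum of \<open>(-1)\<^sup>\<sigma> l\<^sub>r (f\<^bsub>i\<^sub>1\<^esub> \<otimes> \<dots> \<otimes> f\<^bsub>i\<^sub>r\<^esub>)\<close>; the second sign is the Koszul sign for moving each
  \<open>f\<^bsub>i\<^sub>q\<^esub>\<close>, of degree \<open>1 - i\<^sub>q\<close>, past the arguments of all previous blocks.
\<close>

definition ainf_rhs ::
  "('k::field \<Rightarrow> 'b::ab_group_add \<Rightarrow> 'b) \<Rightarrow> (nat \<Rightarrow> 'b list \<Rightarrow> 'b) \<Rightarrow> (nat \<Rightarrow> 'a list \<Rightarrow> 'b) \<Rightarrow>
   int list \<Rightarrow> 'a list \<Rightarrow> 'b" where
  "ainf_rhs sB l f ks as =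
     (\<Sum>js\<in>compositions (length as).
        let r = length js in
        sB ((-1) ^ (\<Sum>q<r. (r - 1 - q) * (js ! q - 1)) *
            (-1) powi (\<Sum>q<r. (1 - int (js ! q)) * sum_list (take (sum_list (take q js)) ks)))
           (l r (map (\<lambda>q. f (js ! q) (block js q as)) [0..<r])))"

definition ainf_morphism ::
  "('k::field \<Rightarrow> 'a::ab_group_add \<Rightarrow> 'a) \<Rightarrow> (int \<Rightarrow> 'a set) \<Rightarrow> (nat \<Rightarrow> 'a list \<Rightarrow> 'a) \<Rightarrow>
   ('k \<Rightarrow> 'b::ab_group_add \<Rightarrow> 'b) \<Rightarrow> (int \<Rightarrow> 'b set) \<Rightarrow> (nat \<Rightarrow> 'b list \<Rightarrow> 'b) \<Rightarrow>
   (nat \<Rightarrow> 'a list \<Rightarrow> 'b) \<Rightarrow> bool" where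
  "ainf_morphism sA GA m sB GB l f \<longleftrightarrow>
     (\<forall>n\<ge>1. graded_multilinear sA GA sB GB n (1 - int n) (f n)) \<and>
     (\<forall>n\<ge>1. \<forall>ks as. length as = n \<and> homogeneous_list GA ks as \<longrightarrow>
        ainf_lhs sB m f ks as = ainf_rhs sB l f ks as)"

definition strict_ainf :: "('a \<Rightarrow> 'a) \<Rightarrow> ('a \<Rightarrow> 'a \<Rightarrow> 'a) \<Rightarrow> nat \<Rightarrow> 'a list \<Rightarrow> 'a::zero" where
  "strict_ainf D mul n as =
     (if n = 1 then D (as ! 0) else if n = 2 then mul (as ! 0) (as ! 1) else 0)"


section \<open>Finite dimensional Lie algebras and their symmetric algebras\<close>

text \<open>
  A Lie algebra of dimension \<open>d\<close> with a chosen basis \<open>x\<^sub>0, \<dots>, x\<^sub>d\<^sub>-\<^sub>1\<close> is given by its structure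
  constants, \<open>[x\<^sub>i, x\<^sub>j] = (\<Sum>k<d. c i j k x\<^sub>k)\<close>.  Values of \<open>c\<close> outside \<open>{..<d}\<close> are never used.
\<close>

definition lie_structure :: "nat \<Rightarrow> (nat \<Rightarrow> nat \<Rightarrow> nat \<Rightarrow> 'k::field_char_0) \<Rightarrow> bool" where
  "lie_structure d c \<longleftrightarrow>
     (\<forall>i<d. \<forall>j<d. \<forall>k<d. c i j k = - c j i k) \<and>
     (\<forall>i<d. \<forall>j<d. \<forall>k<d. \<forall>l<d.
        (\<Sum>e<d. c i j e * c e k l + c j k e * c e i l + c k i e * c e j l) = 0)"

text \<open>Polynomials in the variables \<open>x\<^sub>i\<close>, \<open>i \<in> \<nat>\<close>; those in \<open>sym_alg d\<close> form \<open>S\<gg> = \<bbbK>[x\<^sub>0, \<dots>, x\<^sub>d\<^sub>-\<^sub>1]\<close>.\<close>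

type_synonym 'k spoly = "(nat \<Rightarrow>\<^sub>0 nat) \<Rightarrow>\<^sub>0 'k"

definition sym_alg :: "nat \<Rightarrow> 'k::field_char_0 spoly set" where
  "sym_alg d = {f. \<forall>u\<in>Poly_Mapping.keys f. Poly_Mapping.keys u \<subseteq> {..<d}}"

definition sconst :: "'k::field_char_0 \<Rightarrow> 'k spoly" where
  "sconst r = Poly_Mapping.single 0 r"

definition svar :: "nat \<Rightarrow> 'k::field_char_0 spoly" where
  "svar i = Poly_Mapping.single (Poly_Mapping.single i 1) 1"

definition sdiff :: "nat \<Rightarrow> 'k::field_char_0 spoly \<Rightarrow> 'k spoly" where
  "sdiff i f = (\<Sum>u\<in>Poly_Mapping.keys f.
     Poly_Mapping.single (u - Poly_Mapping.single i 1)
       (of_nat (Poly_Mapping.lookup u i) * Poly_Mapping.lookup f u))"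

text \<open>The adjoint action of \<open>x\<^sub>i\<close> on \<open>S\<gg>\<close>: the derivation with \<open>x\<^sub>j \<mapsto> [x\<^sub>i, x\<^sub>j]\<close>.\<close>

definition sad :: "nat \<Rightarrow> (nat \<Rightarrow> nat \<Rightarrow> nat \<Rightarrow> 'k) \<Rightarrow> nat \<Rightarrow> 'k::field_char_0 spoly \<Rightarrow> 'k spoly" where
  "sad d c i f = (\<Sum>j<d. \<Sum>k<d. sconst (c i j k) * svar k * sdiff j f)"


section \<open>The Duflo map and the product it induces on the symmetric algebra\<close>

text \<open>
  Formal power series on \<open>\<gg>\<close> are written as series in an auxiliary variable \<open>t\<close> whose \<open>t\<^sup>n\<close>
  coefficient is the homogeneous part of degree \<open>n\<close>, a polynomial in the coordinates \<open>\<xi>\<^sub>i\<close> of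
  \<open>x = (\<Sum>i<d. \<xi>\<^sub>i x\<^sub>i)\<close>; \<open>\<xi>\<^sub>i\<close> is represented by \<open>svar i\<close>.  Thus \<open>duflo_J\<close> is \<open>J(t x)\<close>.
\<close>

definition generic_ad :: "nat \<Rightarrow> (nat \<Rightarrow> nat \<Rightarrow> nat \<Rightarrow> 'k) \<Rightarrow> 'k::field_char_0 spoly mat" where
  "generic_ad d c = mat d d (\<lambda>(k, j). \<Sum>i<d. sconst (c i j k) * svar i)"

definition duflo_series :: "'k::field_char_0 fps" where
  "duflo_series = (fps_exp (1 / 2) - fps_exp (- (1 / 2))) / fps_X"

definition duflo_J :: "nat \<Rightarrow> (nat \<Rightarrow> nat \<Rightarrow> nat \<Rightarrow> 'k) \<Rightarrow> 'k::field_char_0 spoly fps" where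
  "duflo_J d c = det (mat d d (\<lambda>(i, j).
     Abs_fps (\<lambda>n. sconst (fps_nth duflo_series n) * (generic_ad d c ^\<^sub>m n) $$ (i, j))))"

definition duflo_J_half :: "nat \<Rightarrow> (nat \<Rightarrow> nat \<Rightarrow> nat \<Rightarrow> 'k) \<Rightarrow> 'k::field_char_0 spoly fps" where
  "duflo_J_half d c = (THE F. F ^ 2 = duflo_J d c \<and> fps_nth F 0 = 1)"

definition sdiff_monom :: "(nat \<Rightarrow>\<^sub>0 nat) \<Rightarrow> 'k::field_char_0 spoly \<Rightarrow> 'k spoly" where
  "sdiff_monom u =
     fold (\<lambda>i. sdiff i ^^ Poly_Mapping.lookup u i) (sorted_list_of_set (Poly_Mapping.keys u))"

text \<open>The constant coefficient operator \<open>P(\<partial>/\<partial>x\<^sub>0, \<dots>, \<partial>/\<partial>x\<^sub>d\<^sub>-\<^sub>1)\<close>.\<close>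

definition const_coeff_op :: "'k spoly \<Rightarrow> 'k::field_char_0 spoly \<Rightarrow> 'k spoly" where
  "const_coeff_op P f =
     (\<Sum>u\<in>Poly_Mapping.keys P. sconst (Poly_Mapping.lookup P u) * sdiff_monom u f)"

text \<open>\<open>Sum_any\<close> sums the nonzero terms; here only those with \<open>n\<close> at most the degree of \<open>f\<close>.\<close>

definition J_half_op ::
  "nat \<Rightarrow> (nat \<Rightarrow> nat \<Rightarrow> nat \<Rightarrow> 'k) \<Rightarrow> 'k::field_char_0 spoly \<Rightarrow> 'k spoly" where
  "J_half_op d c f = Sum_any (\<lambda>n. const_coeff_op (fps_nth (duflo_J_half d c) n) f)"

text \<open>Words form a monoid under concatenation, so \<open>word \<Rightarrow>\<^sub>0 'k\<close> is the free associative algebra.\<close>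

datatype word = Word (letters: "nat list")

instantiation word :: monoid_add
begin

definition zero_word :: word where "0 = Word []"
definition plus_word :: "word \<Rightarrow> word \<Rightarrow> word" where "v + w = Word (letters v @ letters w)"

instance by standard (auto simp: zero_word_def plus_word_def)

end

definition tensor_ring :: "nat \<Rightarrow> (word \<Rightarrow>\<^sub>0 'k::field_char_0) ring" where
  "tensor_ring d =
     \<lparr> carrier = {a. \<forall>w\<in>Poly_Mapping.keys a. set (letters w) \<subseteq> {..<d}},
       monoid.mult = (*), one = 1, zero = 0, add = (+) \<rparr>"

definition lie_relations ::
  "nat \<Rightarrow> (nat \<Rightarrow> nat \<Rightarrow> nat \<Rightarrow> 'k) \<Rightarrow> (word \<Rightarrow>\<^sub>0 'k::field_char_0) set" where
  "lie_relations d c =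
     {Poly_Mapping.single (Word [i, j]) 1 - Poly_Mapping.single (Word [j, i]) 1
        - (\<Sum>k<d. Poly_Mapping.single (Word [k]) (c i j k)) | i j. i < d \<and> j < d}"

definition lie_ideal ::
  "nat \<Rightarrow> (nat \<Rightarrow> nat \<Rightarrow> nat \<Rightarrow> 'k) \<Rightarrow> (word \<Rightarrow>\<^sub>0 'k::field_char_0) set" where
  "lie_ideal d c = Idl\<^bsub>tensor_ring d\<^esub> (lie_relations d c)"

definition enveloping_algebra ::
  "nat \<Rightarrow> (nat \<Rightarrow> nat \<Rightarrow> nat \<Rightarrow> 'k) \<Rightarrow> (word \<Rightarrow>\<^sub>0 'k::field_char_0) set ring" where
  "enveloping_algebra d c = tensor_ring d Quot lie_ideal d c"

definition monom_list :: "(nat \<Rightarrow>\<^sub>0 nat) \<Rightarrow> nat list" where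
  "monom_list u = concat (map (\<lambda>i. replicate (Poly_Mapping.lookup u i) i)
                              (sorted_list_of_set (Poly_Mapping.keys u)))"

definition symmetrization ::
  "nat \<Rightarrow> (nat \<Rightarrow> nat \<Rightarrow> nat \<Rightarrow> 'k) \<Rightarrow> 'k::field_char_0 spoly \<Rightarrow> (word \<Rightarrow>\<^sub>0 'k) set" where
  "symmetrization d c f = lie_ideal d c +>\<^bsub>tensor_ring d\<^esub>
     (\<Sum>u\<in>Poly_Mapping.keys f. let xs = monom_list u in
        \<Sum>\<sigma> | \<sigma> permutes {..<length xs}.
          Poly_Mapping.single (Word (permute_list \<sigma> xs))
            (Poly_Mapping.lookup f u / fact (length xs)))"

definition duflo ::
  "nat \<Rightarrow> (nat \<Rightarrow> nat \<Rightarrow> nat \<Rightarrow> 'k) \<Rightarrow> 'k::field_char_0 spoly \<Rightarrow> (word \<Rightarrow>\<^sub>0 'k) set" where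
  "duflo d c = symmetrization d c \<circ> J_half_op d c"

definition duflo_mult ::
  "nat \<Rightarrow> (nat \<Rightarrow> nat \<Rightarrow> nat \<Rightarrow> 'k) \<Rightarrow> 'k::field_char_0 spoly \<Rightarrow> 'k spoly \<Rightarrow> 'k spoly" where
  "duflo_mult d c f g =
     inv_into (sym_alg d) (duflo d c) (duflo d c f \<otimes>\<^bsub>enveloping_algebra d c\<^esub> duflo d c g)"


section \<open>The algebra \<open>A = S\<gg> \<otimes> \<Lambda>\<gg>\<^sup>*\<close>\<close>

text \<open>
  \<open>Poly_Mapping.lookup a I\<close> is the coefficient in \<open>S\<gg>\<close> of \<open>p\<^sup>I = p\<^bsup>i\<^sub>1\<^esup> \<cdots> p\<^bsup>i\<^sub>q\<^esup>\<close>, where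
  \<open>I = {i\<^sub>1 < \<dots> < i\<^sub>q}\<close>.
\<close>

type_synonym 'k sext = "nat set \<Rightarrow>\<^sub>0 'k spoly"

definition sext_grade :: "nat \<Rightarrow> int \<Rightarrow> 'k::field_char_0 sext set" where
  "sext_grade d k = {a. \<forall>I\<in>Poly_Mapping.keys a.
     I \<subseteq> {..<d} \<and> int (card I) = k \<and> Poly_Mapping.lookup a I \<in> sym_alg d}"

definition sext_scale :: "'k \<Rightarrow> 'k::field_char_0 sext \<Rightarrow> 'k sext" where
  "sext_scale r = Poly_Mapping.map (\<lambda>f. sconst r * f)"

text \<open>\<open>p\<^sup>I p\<^sup>J = wedge_sign I J p\<^bsup>I \<union> J\<^esup>\<close>.\<close>

definition wedge_sign :: "nat set \<Rightarrow> nat set \<Rightarrow> 'k::field_char_0" where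
  "wedge_sign I J = (if I \<inter> J = {} then (-1) ^ card {(i, j). i \<in> I \<and> j \<in> J \<and> j < i} else 0)"

text \<open>The product \<open>mS \<otimes> m\<^sub>\<and>\<close>, where \<open>mS\<close> is a product on \<open>S\<gg>\<close>.\<close>

definition sext_mult ::
  "('k spoly \<Rightarrow> 'k spoly \<Rightarrow> 'k spoly) \<Rightarrow> 'k::field_char_0 sext \<Rightarrow> 'k sext \<Rightarrow> 'k sext" where
  "sext_mult mS a b = (\<Sum>I\<in>Poly_Mapping.keys a. \<Sum>J\<in>Poly_Mapping.keys b.
     Poly_Mapping.single (I \<union> J)
       (sconst (wedge_sign I J) * mS (Poly_Mapping.lookup a I) (Poly_Mapping.lookup b J)))"

definition sext_x :: "nat \<Rightarrow> 'k::field_char_0 sext" where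
  "sext_x i = Poly_Mapping.single {} (svar i)"

definition sext_p :: "nat \<Rightarrow> 'k::field_char_0 sext" where
  "sext_p i = Poly_Mapping.single {i} 1"

definition sext_dx :: "nat \<Rightarrow> 'k::field_char_0 sext \<Rightarrow> 'k sext" where
  "sext_dx l = Poly_Mapping.map (sdiff l)"

text \<open>The odd left derivation \<open>\<partial>/\<partial>p\<^sup>l\<close>.\<close>

definition sext_dp :: "nat \<Rightarrow> 'k::field_char_0 sext \<Rightarrow> 'k sext" where
  "sext_dp l a = (\<Sum>I\<in>{I \<in> Poly_Mapping.keys a. l \<in> I}.
     Poly_Mapping.single (I - {l}) ((-1) ^ card {i \<in> I. i < l} * Poly_Mapping.lookup a I))"

text \<open>The grading involution \<open>a \<mapsto> (-1)\<^bsup>\<bar>a\<bar>\<^esup> a\<close>.\<close>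

definition sext_inv :: "'k::field_char_0 sext \<Rightarrow> 'k sext" where
  "sext_inv a = (\<Sum>I\<in>Poly_Mapping.keys a.
     Poly_Mapping.single I ((-1) ^ card I * Poly_Mapping.lookup a I))"

text \<open>
  The Chevalley--Eilenberg differential
  \<open>(\<Sum>i. p\<^sup>i ad\<^bsub>x\<^sub>i\<^esub>) - 1/2 (\<Sum>i j k. c i j k p\<^sup>i p\<^sup>j \<partial>/\<partial>p\<^sup>k)\<close>; the second term is
  dual to the bracket, \<open>(d\<omega>)(x, y) = - \<omega>([x, y])\<close> for \<open>\<omega> \<in> \<gg>\<^sup>*\<close>.
\<close>

definition ce_diff ::
  "nat \<Rightarrow> (nat \<Rightarrow> nat \<Rightarrow> nat \<Rightarrow> 'k) \<Rightarrow> 'k::field_char_0 sext \<Rightarrow> 'k sext" where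
  "ce_diff d c a =
     (\<Sum>i<d. sext_mult (*) (sext_p i) (Poly_Mapping.map (sad d c i) a))
     - sext_scale (1 / 2) (\<Sum>i<d. \<Sum>j<d. \<Sum>k<d.
         sext_scale (c i j k) (sext_mult (*) (sext_mult (*) (sext_p i) (sext_p j)) (sext_dp k a)))"


section \<open>Admissible directed graphs and the spaces \<open>dgraphs(n)\<close>\<close>

text \<open>
  A graph \<open>(m, es)\<close> with \<open>n\<close> external vertices has the internal vertices \<open>Internal i\<close>, \<open>i < m\<close>,
  the external vertices \<open>External j\<close>, \<open>j < n\<close>, and the edges \<open>es\<close> in their linear order; an
  edge is a pair (source, target).  The labels of the internal vertices are divided out in
  \<open>dgraph_relations\<close> below.
\<close>

datatype vertex = Internal nat | External nat

type_synonym dgraph = "nat \<times> (vertex \<times> vertex) list"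

definition indegree :: "(vertex \<times> vertex) list \<Rightarrow> vertex \<Rightarrow> nat" where
  "indegree es v = length (filter (\<lambda>e. snd e = v) es)"

definition outdegree :: "(vertex \<times> vertex) list \<Rightarrow> vertex \<Rightarrow> nat" where
  "outdegree es v = length (filter (\<lambda>e. fst e = v) es)"

definition vertices :: "nat \<Rightarrow> nat \<Rightarrow> vertex set" where
  "vertices n m = Internal ` {..<m} \<union> External ` {..<n}"

fun simple_dgraph :: "nat \<Rightarrow> dgraph \<Rightarrow> bool" where
  "simple_dgraph n (m, es) \<longleftrightarrow>
     set es \<subseteq> vertices n m \<times> vertices n m \<and>
     distinct es \<and>
     (\<forall>(u, v)\<in>set es. u \<noteq> v) \<and>
     (\<forall>i<m. \<exists>j<n. (Internal i, External j) \<in> (set es \<union> (set es)\<inverse>)\<^sup>*)"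

definition small_vertex :: "(vertex \<times> vertex) list \<Rightarrow> vertex \<Rightarrow> bool" where
  "small_vertex es v \<longleftrightarrow>
     indegree es v + outdegree es v \<le> 3 \<and> indegree es v \<le> 1 \<and> outdegree es v \<le> 2"

fun admissible :: "nat \<Rightarrow> dgraph \<Rightarrow> bool" where
  "admissible n (m, es) \<longleftrightarrow> simple_dgraph n (m, es) \<and> (\<forall>i<m. small_vertex es (Internal i))"

fun four_valent_at :: "nat \<Rightarrow> dgraph \<Rightarrow> nat \<Rightarrow> bool" where
  "four_valent_at n (m, es) v \<longleftrightarrow> simple_dgraph n (m, es) \<and> v < m \<and>
     indegree es (Internal v) = 1 \<and> outdegree es (Internal v) = 3 \<and>
     (\<forall>i<m. i \<noteq> v \<longrightarrow> small_vertex es (Internal i))"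

fun dgraph_degree :: "dgraph \<Rightarrow> int" where
  "dgraph_degree (m, es) = 2 * int m - int (length es)"

text \<open>
  Splitting \<open>Internal v\<close> into \<open>Internal v\<close> and the new vertex \<open>Internal m\<close>, joined by the new last
  edge \<open>(Internal v, Internal m)\<close>.  The adjacent edges with positions in \<open>P\<close> are reconnected to
  \<open>Internal m\<close>, the others stay at \<open>Internal v\<close>.
\<close>

definition adjacent_positions :: "(vertex \<times> vertex) list \<Rightarrow> nat \<Rightarrow> nat set" where
  "adjacent_positions es v =
     {q. q < length es \<and> (fst (es ! q) = Internal v \<or> snd (es ! q) = Internal v)}"

definition move_end :: "nat \<Rightarrow> nat \<Rightarrow> vertex \<Rightarrow> vertex" where
  "move_end v m w = (if w = Internal v then Internal m else w)"

fun split_vertex :: "dgraph \<Rightarrow> nat \<Rightarrow> nat set \<Rightarrow> dgraph" where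
  "split_vertex (m, es) v P =
     (m + 1,
      map (\<lambda>q. if q \<in> P then map_prod (move_end v m) (move_end v m) (es ! q) else es ! q)
          [0..<length es]
      @ [(Internal v, Internal m)])"

definition ihx_sum :: "nat \<Rightarrow> dgraph \<Rightarrow> nat \<Rightarrow> (dgraph \<Rightarrow>\<^sub>0 'k::field_char_0)" where
  "ihx_sum n G v = (\<Sum>P | P \<subseteq> adjacent_positions (snd G) v \<and> admissible n (split_vertex G v P).
     Poly_Mapping.single (split_vertex G v P) 1)"

fun relabel_vertex :: "(nat \<Rightarrow> nat) \<Rightarrow> vertex \<Rightarrow> vertex" where
  "relabel_vertex \<rho> (Internal i) = Internal (\<rho> i)"
| "relabel_vertex \<rho> (External j) = External j"

text \<open>
  In order: independence of the labeling of internal vertices, \<open>\<Gamma>\<^sup>\<sigma> = (-1)\<^bsup>\<bar>\<sigma>\<bar>\<^esup> \<Gamma>\<close>, and the two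
  kinds of generalized IHX relations.
\<close>

definition dgraph_relations :: "nat \<Rightarrow> (dgraph \<Rightarrow>\<^sub>0 'k::field_char_0) set" where
  "dgraph_relations n =
     {Poly_Mapping.single (m, map (map_prod (relabel_vertex \<rho>) (relabel_vertex \<rho>)) es) 1
        - Poly_Mapping.single (m, es) 1 | m es \<rho>. admissible n (m, es) \<and> \<rho> permutes {..<m}} \<union>
     {Poly_Mapping.single (m, permute_list \<sigma> es) 1
        - Poly_Mapping.single (m, es) (of_int (sign \<sigma>)) | m es \<sigma>.
        admissible n (m, es) \<and> \<sigma> permutes {..<length es}} \<union>
     {ihx_sum n G v | G v. admissible n G \<and> v < fst G} \<union>
     {ihx_sum n G v | G v. four_valent_at n G v}"

definition dgraph_scale :: "'k \<Rightarrow> (dgraph \<Rightarrow>\<^sub>0 'k::field_char_0) \<Rightarrow> (dgraph \<Rightarrow>\<^sub>0 'k)" where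
  "dgraph_scale r = Poly_Mapping.map ((*) r)"

definition dgraph_chains :: "nat \<Rightarrow> nat \<Rightarrow> int \<Rightarrow> (dgraph \<Rightarrow>\<^sub>0 'k::field_char_0) set" where
  "dgraph_chains n m k =
     {a. \<forall>G\<in>Poly_Mapping.keys a. admissible n G \<and> fst G = m \<and> dgraph_degree G = k}"

text \<open>
  The part of \<open>dgraphs(n)\<close> of degree \<open>k\<close> spanned by graphs with \<open>m\<close> internal vertices, as the
  set of residue classes modulo the relations.  The relations preserve \<open>m\<close> and \<open>k\<close>, so
  \<open>dgraphs(n)\<close> is the direct sum of these parts.
\<close>

definition dgraphs :: "nat \<Rightarrow> nat \<Rightarrow> int \<Rightarrow> (dgraph \<Rightarrow>\<^sub>0 'k::field_char_0) set set" where
  "dgraphs n m k =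
     {{b \<in> dgraph_chains n m k. b - a \<in> module.span dgraph_scale (dgraph_relations n)} | a.
        a \<in> dgraph_chains n m k}"

text \<open>
  A part with fixed \<open>n\<close>, \<open>m\<close>, \<open>k\<close> involves finitely many graphs only.  Hence a possibly infinite
  linear combination of graphs, homogeneous of degree \<open>k\<close>, is a family of elements of these
  parts, one for each \<open>m\<close>.
\<close>

definition dgraph_series :: "nat \<Rightarrow> int \<Rightarrow> (nat \<Rightarrow> (dgraph \<Rightarrow>\<^sub>0 'k::field_char_0) set) set" where
  "dgraph_series n k = {X. \<forall>m. X m \<in> dgraphs n m k}"


section \<open>The representation \<open>B\<close>\<close>

definition lie_pi :: "nat \<Rightarrow> (nat \<Rightarrow> nat \<Rightarrow> nat \<Rightarrow> 'k) \<Rightarrow> 'k::field_char_0 sext" where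
  "lie_pi d c = (\<Sum>i<d. \<Sum>j<d. \<Sum>k<d.
     sext_scale (c i j k) (sext_mult (*) (sext_x k) (sext_mult (*) (sext_p i) (sext_p j))))"

text \<open>
  The \<open>l\<close>-th summand of \<open>\<tau>\<^sub>i\<^sub>j\<close> on a pure tensor: \<open>\<partial>/\<partial>x\<^sub>l\<close> acts on the factor \<open>j\<close> and \<open>\<partial>/\<partial>p\<^sup>l\<close> on
  the factor \<open>i\<close>.  By the Koszul rule the odd operator \<open>\<partial>/\<partial>p\<^sup>l\<close> produces the sign \<open>(-1)\<^bsup>\<bar>a\<bar>\<^esup>\<close> for
  each factor \<open>a\<close> it passes.
\<close>

definition tau_summand :: "nat \<Rightarrow> nat \<Rightarrow> nat \<Rightarrow> 'k::field_char_0 sext list \<Rightarrow> 'k sext list" where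
  "tau_summand l i j ts =
     map (\<lambda>q. let a = (if q = j then sext_dx l (ts ! q) else ts ! q) in
              if q < i then sext_inv a else if q = i then sext_dp l a else a)
         [0..<length ts]"

text \<open>\<open>\<mu> (\<Prod> \<tau>\<^sub>i\<^sub>j (t\<^sub>1 \<otimes> \<dots> \<otimes> t\<^sub>N))\<close>, where the first edge in the list acts first.\<close>

fun apply_edges :: "nat \<Rightarrow> (nat \<times> nat) list \<Rightarrow> 'k::field_char_0 sext list \<Rightarrow> 'k sext" where
  "apply_edges d [] ts = foldr (sext_mult (*)) ts (Poly_Mapping.single {} 1)"
| "apply_edges d ((i, j) # es) ts = (\<Sum>l<d. apply_edges d es (tau_summand l i j ts))"

fun position :: "nat \<Rightarrow> vertex \<Rightarrow> nat" where
  "position m (Internal i) = i"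
| "position m (External j) = m + j"

fun B_graph ::
  "nat \<Rightarrow> (nat \<Rightarrow> nat \<Rightarrow> nat \<Rightarrow> 'k) \<Rightarrow> dgraph \<Rightarrow> 'k::field_char_0 sext list \<Rightarrow> 'k sext" where
  "B_graph d c (m, es) fs =
     apply_edges d (map (map_prod (position m) (position m)) es) (replicate m (lie_pi d c) @ fs)"

definition B_chain ::
  "nat \<Rightarrow> (nat \<Rightarrow> nat \<Rightarrow> nat \<Rightarrow> 'k) \<Rightarrow> (dgraph \<Rightarrow>\<^sub>0 'k) \<Rightarrow>
   'k::field_char_0 sext list \<Rightarrow> 'k sext" where
  "B_chain d c a fs =
     (\<Sum>G\<in>Poly_Mapping.keys a. sext_scale (Poly_Mapping.lookup a G) (B_graph d c G fs))"

text \<open>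
  \<open>B\<close> vanishes on the relations when \<open>c\<close> is a Lie structure, so the choice of representatives is
  immaterial.  In \<open>B_series\<close> only finitely many \<open>m\<close> contribute for given \<open>fs\<close>, since each edge
  lowers the degree in the \<open>x\<^sub>i\<close> by one and there are \<open>2 m - k\<close> edges in degree \<open>k\<close>, while \<open>m\<close> factors
  \<open>lie_pi\<close>, linear in the \<open>x\<^sub>i\<close>, raise it by \<open>m\<close> only.
\<close>

definition B_class ::
  "nat \<Rightarrow> (nat \<Rightarrow> nat \<Rightarrow> nat \<Rightarrow> 'k) \<Rightarrow> (dgraph \<Rightarrow>\<^sub>0 'k) set \<Rightarrow>
   'k::field_char_0 sext list \<Rightarrow> 'k sext" where
  "B_class d c X = B_chain d c (SOME a. a \<in> X)"

definition B_series ::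
  "nat \<Rightarrow> (nat \<Rightarrow> nat \<Rightarrow> nat \<Rightarrow> 'k) \<Rightarrow> (nat \<Rightarrow> (dgraph \<Rightarrow>\<^sub>0 'k) set) \<Rightarrow>
   'k::field_char_0 sext list \<Rightarrow> 'k sext" where
  "B_series d c X fs = Sum_any (\<lambda>m. B_class d c (X m) fs)"

end

theory Submission
  imports Defs
begin

text \<open>
  All graphs are evaluated on the two-dimensional Lie algebra \<open>[x\<^sub>0, x\<^sub>1] = x\<^sub>1\<close>.  A graph with \<open>m\<close> internal
  and \<open>n\<close> external vertices lowers the polynomial degree in the \<open>x\<^sub>i\<close> by \<open>m + n - 1\<close>, so the constant term
  of \<open>f\<^sub>n\<close> on monomials of total degree \<open>m + n - 1\<close> only involves the finitely many graphs with \<open>m\<close>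
  internal vertices.  Four constant terms of the \<open>A\<^sub>\<infinity>\<close>-equations already contradict each other: on
  \<open>(x\<^sub>0, x\<^sub>0)\<close> the Duflo factor contributes \<open>-1/24\<close>, which comes from the quadratic
  term \<open>tr (ad\<^sub>x\<^sup>2) / 48\<close> of the square root of \<open>J\<close>; on \<open>(x\<^sub>0, p\<^sup>1, x\<^sub>1)\<close> the same number is expressed by values of \<open>f\<^sub>3\<close>,
  and on \<open>(x\<^sub>0, p\<^sup>0, p\<^sup>1, x\<^sub>1)\<close> and \<open>(x\<^sub>0, p\<^sup>0, p\<^sup>0, x\<^sub>0)\<close> these values are products of values of \<open>f\<^sub>2\<close> that
  cancel.  Universality enters through the identities between values of one graph on different monomials.
\<close>

text \<open>These rules would turn the exponent vectors \<open>Poly_Mapping.single 0 n\<close> into numerals.\<close>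

declare Poly_Mapping.single_numeral [simp del] Poly_Mapping.single_one [simp del]

lemma single_one_spoly [simp]: "Poly_Mapping.single 0 1 = (1 :: 'k::field_char_0 spoly)"
  by (rule Poly_Mapping.single_one)

section \<open>The Duflo product of the two-dimensional non-abelian Lie algebra\<close>

text \<open>\<open>sdiff\<close> is a sum over monomials; reading it coefficientwise makes linearity
  and iterated derivatives accessible to simplification.\<close>

lemma lookup_sdiff:
  "Poly_Mapping.lookup (sdiff i f) u =
     of_nat (Suc (Poly_Mapping.lookup u i)) * Poly_Mapping.lookup f (u + Poly_Mapping.single i 1)"
proof -
  \<comment> \<open>Subtraction of exponents is truncated, so \<open>w = u\<close> also satisfies
    the left side when the i-th exponent of \<open>w\<close> is 0; those terms carry the factor
    0.\<close>
  have *: "w - Poly_Mapping.single i 1 = u \<longleftrightarrow> w = u + Poly_Mapping.single i 1"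
    if "Poly_Mapping.lookup w i \<noteq> 0" for w :: "nat \<Rightarrow>\<^sub>0 nat"
    using that
    by (auto simp: poly_mapping_eq_iff fun_eq_iff lookup_minus lookup_add lookup_single when_def)
  have "Poly_Mapping.lookup (sdiff i f) u =
      (\<Sum>w\<in>Poly_Mapping.keys f. if w = u + Poly_Mapping.single i 1
         then of_nat (Poly_Mapping.lookup w i) * Poly_Mapping.lookup f w else 0)"
    unfolding sdiff_def lookup_sum lookup_single
  proof (rule sum.cong, simp)
    fix w
    show "(of_nat (Poly_Mapping.lookup w i) * Poly_Mapping.lookup f w when
         w - Poly_Mapping.single i 1 = u) =
      (if w = u + Poly_Mapping.single i 1
       then of_nat (Poly_Mapping.lookup w i) * Poly_Mapping.lookup f w else 0)"
      using *[of w] by (cases "Poly_Mapping.lookup w i = 0") (auto simp: when_def)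
  qed
  also have "\<dots> = of_nat (Poly_Mapping.lookup (u + Poly_Mapping.single i 1) i) *
      Poly_Mapping.lookup f (u + Poly_Mapping.single i 1)"
    by (simp add: sum.delta' in_keys_iff)
  finally show ?thesis by (simp add: lookup_add)
qed

lemma lookup_sdiff_funpow:
  "Poly_Mapping.lookup ((sdiff i ^^ n) f) u =
     fact (Poly_Mapping.lookup u i + n) / fact (Poly_Mapping.lookup u i) *
     Poly_Mapping.lookup f (u + Poly_Mapping.single i n)"
proof (induction n arbitrary: u)
  case (Suc n)
  have "1 + of_nat m \<noteq> (0 :: 'a)" for m
    by (metis of_nat_Suc of_nat_neq_0)
  then show ?case
    by (simp add: lookup_sdiff Suc lookup_add add.assoc flip: single_add)
qed simp

lemma lookup_sconst_mult:
  "Poly_Mapping.lookup (sconst r * f) u = r * Poly_Mapping.lookup f u"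
  by (simp add: sconst_def lookup_mult lookup_single when_mult Sum_any_when_equal Sum_any_when_equal')

lemma sdiff_single:
  "sdiff i (Poly_Mapping.single u r) =
     Poly_Mapping.single (u - Poly_Mapping.single i 1) (of_nat (Poly_Mapping.lookup u i) * r)"
  by (simp add: sdiff_def)

lemma sdiff_diff: "sdiff i (f - g) = sdiff i f - sdiff i g"
  by (rule poly_mapping_eqI) (simp add: lookup_sdiff lookup_minus algebra_simps)

section \<open>The Duflo factor J and its square root for [x_0, x_1] = x_1\<close>

definition aff1 :: "nat \<Rightarrow> nat \<Rightarrow> nat \<Rightarrow> 'k::field_char_0" where
  "aff1 i j k = (if i = 0 \<and> j = 1 \<and> k = 1 then 1 else if i = 1 \<and> j = 0 \<and> k = 1 then - 1 else 0)"

lemma lie_structure_aff1: "lie_structure 2 aff1"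
  by (auto simp: lie_structure_def aff1_def numeral_2_eq_2 less_Suc_eq)

text \<open>The substitution of \<xi>_0 t for t, where \<xi>_0 is the coordinate along x_0.\<close>

definition svar_fps :: "'k::field_char_0 fps \<Rightarrow> 'k spoly fps" where
  "svar_fps a = Abs_fps (\<lambda>n. Poly_Mapping.single (Poly_Mapping.single 0 n) (fps_nth a n))"

lemma sum_single_same: "(\<Sum>x\<in>A. Poly_Mapping.single k (f x)) = Poly_Mapping.single k (\<Sum>x\<in>A. f x)"
  by (induction A rule: infinite_finite_induct) (simp_all add: single_add)

lemma svar_fps_mult: "svar_fps (a * b) = svar_fps a * svar_fps b"
proof (rule fps_ext)
  fix n
  have "fps_nth (svar_fps a * svar_fps b) n =
      (\<Sum>i=0..n. Poly_Mapping.single (Poly_Mapping.single 0 n) (fps_nth a i * fps_nth b (n - i)))"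
    unfolding fps_mult_nth
    by (rule sum.cong) (auto simp: svar_fps_def mult_single simp flip: single_add)
  then show "fps_nth (svar_fps (a * b)) n = fps_nth (svar_fps a * svar_fps b) n"
    by (simp add: svar_fps_def sum_single_same fps_mult_nth)
qed

lemma svar_power: "svar i ^ n = Poly_Mapping.single (Poly_Mapping.single i n) 1"
  by (induction n) (simp_all add: svar_def mult_single flip: single_add)

text \<open>The matrix of ad_x is lower triangular with diagonal 0, \<xi>_0. The determinant is thus
  the product of the values of the one-variable series at 0 and at \<xi>_0, and the first of these
  is 1.\<close>

lemma duflo_J_aff1: "duflo_J 2 aff1 = (svar_fps duflo_series :: 'k::field_char_0 spoly fps)"
proof -
  let ?M = "generic_ad 2 aff1 :: 'k spoly mat"
  have M: "?M \<in> carrier_mat 2 2"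
    by (simp add: generic_ad_def)
  have entries: "?M $$ (0, 0) = 0" "?M $$ (0, 1) = 0" "?M $$ (1, 1) = svar 0"
    by (simp_all add: generic_ad_def aff1_def numeral_2_eq_2 sconst_def)
  have pow: "(?M ^\<^sub>m n) $$ (0, 0) = (if n = 0 then 1 else 0) \<and> (?M ^\<^sub>m n) $$ (0, 1) = 0 \<and>
      (?M ^\<^sub>m n) $$ (1, 1) = svar 0 ^ n" for n
  proof (induction n)
    case (Suc n)
    have P: "?M ^\<^sub>m n \<in> carrier_mat 2 2"
      using M by simp
    have "(?M ^\<^sub>m Suc n) $$ (i, j) =
        (?M ^\<^sub>m n) $$ (i, 0) * ?M $$ (0, j) + (?M ^\<^sub>m n) $$ (i, 1) * ?M $$ (1, j)"
      if "i < 2" "j < 2" for i j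
      using that P M by (simp add: scalar_prod_def numeral_2_eq_2)
    then show ?case
      using Suc entries by (simp add: mult.commute)
  qed (use M in simp)
  let ?F = "\<lambda>i j. Abs_fps (\<lambda>n. sconst (fps_nth duflo_series n) * (?M ^\<^sub>m n) $$ (i, j))"
  have s0: "fps_nth duflo_series 0 = (1 :: 'k)"
    by (simp add: duflo_series_def fps_divide_def)
  have "duflo_J 2 aff1 = ?F 0 0 * ?F 1 1"
    unfolding duflo_J_def using pow
    by (subst det_lower_triangular[of 2])
      (auto simp: fps_eq_iff diag_mat_def numeral_2_eq_2 less_Suc_eq)
  also have "?F 0 0 = 1"
    using s0 pow by (auto simp: fps_eq_iff sconst_def)
  also have "?F 1 1 = svar_fps duflo_series"
    using pow by (auto simp: fps_eq_iff svar_fps_def svar_power sconst_def mult_single)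
  finally show ?thesis by simp
qed

text \<open>The constant choice function 1 is legitimate because \<open>duflo_series\<close> has
  constant term 1; it selects the root with constant term 1.\<close>

definition duflo_root :: "'k::field_char_0 fps" where
  "duflo_root = fps_radical (\<lambda>_ _. 1) 2 duflo_series"

lemma fps_nth_duflo_series:
  "fps_nth (duflo_series :: 'k::field_char_0 fps) n =
     ((1 / 2) ^ Suc n - (- (1 / 2)) ^ Suc n) / fact (Suc n)"
  by (simp add: duflo_series_def fps_divide_def diff_divide_distrib del: fact_Suc power_Suc)

lemma duflo_root_square: "duflo_root ^ 2 = (duflo_series :: 'k::field_char_0 fps)"
  using power_radical[of "duflo_series :: 'k fps" "\<lambda>_ _. 1" 1]
  by (simp add: duflo_root_def fps_nth_duflo_series numeral_2_eq_2)

lemma duflo_root_0: "fps_nth (duflo_root :: 'k::field_char_0 fps) 0 = 1"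
  by (simp add: duflo_root_def)

lemma duflo_root_1: "fps_nth (duflo_root :: 'k::field_char_0 fps) 1 = 0"
proof -
  have "fps_nth (duflo_root ^ 2 :: 'k fps) 1 = 0"
    by (simp add: duflo_root_square fps_nth_duflo_series)
  then show ?thesis
    by (simp add: power2_eq_square fps_mult_nth duflo_root_0)
qed

text \<open>The series starts with 1 + t^2/24 and the root has no linear term, so its quadratic
  coefficient is half of 1/24.\<close>

lemma duflo_root_2: "fps_nth (duflo_root :: 'k::field_char_0 fps) 2 = 1 / 48"
proof -
  have "fps_nth (duflo_root ^ 2 :: 'k fps) 2 = 1 / 24"
    unfolding duflo_root_square by (simp add: fps_nth_duflo_series eval_nat_numeral)
  then have "2 * fps_nth (duflo_root :: 'k fps) 2 = 1 / 24"
    using duflo_root_1[where 'k = 'k]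
    by (simp add: power2_eq_square fps_mult_nth duflo_root_0 numeral_2_eq_2)
  then show ?thesis
    by (simp add: field_simps)
qed

text \<open>Square roots in the integral domain of power series differ by a sign only, and the
  constant term fixes the sign because 1 and -1 differ in characteristic zero.\<close>

lemma duflo_J_half_aff1: "duflo_J_half 2 aff1 = (svar_fps duflo_root :: 'k::field_char_0 spoly fps)"
  unfolding duflo_J_half_def duflo_J_aff1
proof (rule the_equality)
  show *: "svar_fps duflo_root ^ 2 = (svar_fps duflo_series :: 'k spoly fps) \<and>
      fps_nth (svar_fps duflo_root :: 'k spoly fps) 0 = 1"
    by (simp add: power2_eq_square duflo_root_0 flip: svar_fps_mult duflo_root_square)
      (simp add: svar_fps_def duflo_root_0)
  fix F :: "'k spoly fps"
  assume F: "F ^ 2 = svar_fps duflo_series \<and> fps_nth F 0 = 1"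
  have "(1 :: 'k spoly) \<noteq> - 1"
  proof
    assume "(1 :: 'k spoly) = - 1"
    then have "Poly_Mapping.lookup (1 :: 'k spoly) 0 = Poly_Mapping.lookup (- 1 :: 'k spoly) 0"
      by simp
    then show False by simp
  qed
  moreover from F * have "F = svar_fps duflo_root \<or> F = - svar_fps duflo_root"
    by (metis power2_eq_iff)
  ultimately show "F = svar_fps duflo_root"
    using F * by auto
qed

section \<open>The differential operator given by the square root of J\<close>

lemma const_coeff_op_single:
  "const_coeff_op (Poly_Mapping.single (Poly_Mapping.single i n) r) f = sconst r * (sdiff i ^^ n) f"
  by (auto simp: const_coeff_op_def sdiff_monom_def sconst_def)

lemma J_half_op_aff1:
  fixes f :: "'k::field_char_0 spoly"
  assumes "\<And>n. n \<ge> N \<Longrightarrow> (sdiff 0 ^^ n) f = 0"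
  shows "J_half_op 2 aff1 f = (\<Sum>n<N. sconst (fps_nth duflo_root n) * (sdiff 0 ^^ n) f)"
proof -
  have "J_half_op 2 aff1 f = Sum_any (\<lambda>n. sconst (fps_nth duflo_root n) * (sdiff 0 ^^ n) f)"
    by (simp add: J_half_op_def duflo_J_half_aff1 svar_fps_def const_coeff_op_single)
  also have "\<dots> = (\<Sum>n<N. sconst (fps_nth duflo_root n) * (sdiff 0 ^^ n) f)"
    using assms by (intro Sum_any.expand_superset) (auto simp: not_le[symmetric])
  finally show ?thesis .
qed

lemma sdiff_funpow_eq_0:
  fixes f :: "'k::field_char_0 spoly"
  shows "\<exists>N. \<forall>n\<ge>N. (sdiff i ^^ n) f = 0"
proof -
  \<comment> \<open>The sum of the exponents of x_i over all monomials of \<open>f\<close> bounds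
    each of them, so that many derivatives and one more annihilate \<open>f\<close>.\<close>
  define N where "N = Suc (\<Sum>u\<in>Poly_Mapping.keys f. Poly_Mapping.lookup u i)"
  have "(sdiff i ^^ n) f = 0" if "n \<ge> N" for n
  proof (rule poly_mapping_eqI)
    fix u
    have "u + Poly_Mapping.single i n \<notin> Poly_Mapping.keys f"
    proof
      assume u: "u + Poly_Mapping.single i n \<in> Poly_Mapping.keys f"
      then have "Poly_Mapping.lookup (u + Poly_Mapping.single i n) i < N"
        unfolding N_def less_Suc_eq_le by (intro member_le_sum) auto
      with that show False by (simp add: lookup_add)
    qed
    then show "Poly_Mapping.lookup ((sdiff i ^^ n) f) u = Poly_Mapping.lookup 0 u"
      by (simp add: lookup_sdiff_funpow in_keys_iff)
  qed
  then show ?thesis by blast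
qed

text \<open>The n-th derivative by x_0 carries the coefficient of x_0^(k+n) to that of x_0^k. On
  these coefficients the operator is therefore triangular with diagonal 1. This is the fragment of
  the injectivity of the Duflo map that enters the argument.\<close>

lemma J_half_op_aff1_inj:
  fixes f g :: "'k::field_char_0 spoly"
  assumes eq: "\<And>k. Poly_Mapping.lookup (J_half_op 2 aff1 f) (Poly_Mapping.single 0 k) =
      Poly_Mapping.lookup (J_half_op 2 aff1 g) (Poly_Mapping.single 0 k)"
  shows "Poly_Mapping.lookup f (Poly_Mapping.single 0 k) =
      Poly_Mapping.lookup g (Poly_Mapping.single 0 k)"
proof -
  obtain N1 N2 where N12: "\<And>n. n \<ge> N1 \<Longrightarrow> (sdiff 0 ^^ n) f = 0" "\<And>n. n \<ge> N2 \<Longrightarrow> (sdiff 0 ^^ n) g = 0"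
    using sdiff_funpow_eq_0 by meson
  \<comment> \<open>\<open>Suc\<close> guarantees that the summand \<open>n = 0\<close>, which
    isolates \<open>h k\<close>, is present.\<close>
  define N where "N = Suc (max N1 N2)"
  define h where "h k = Poly_Mapping.lookup f (Poly_Mapping.single 0 k) -
      Poly_Mapping.lookup g (Poly_Mapping.single 0 k)" for k
  have N: "(sdiff 0 ^^ n) f = 0" "(sdiff 0 ^^ n) g = 0" if "n \<ge> N" for n
    using that N12 by (auto simp: N_def)
  have lookup_J: "Poly_Mapping.lookup (J_half_op 2 aff1 p) (Poly_Mapping.single 0 k) =
      (\<Sum>n<N. fps_nth duflo_root n * (fact (k + n) / fact k *
         Poly_Mapping.lookup p (Poly_Mapping.single 0 (k + n))))"
    if "\<And>n. n \<ge> N \<Longrightarrow> (sdiff 0 ^^ n) p = 0" for p :: "'k spoly" and k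
    by (subst J_half_op_aff1[OF that])
      (simp_all add: lookup_sum lookup_sconst_mult lookup_sdiff_funpow flip: single_add)
  have h_sum: "(\<Sum>n<N. fps_nth duflo_root n * (fact (k + n) / fact k * h (k + n))) = 0" for k
    using eq[of k] lookup_J[of f k] lookup_J[of g k] N
    by (simp add: h_def right_diff_distrib diff_divide_distrib sum_subtractf)
  \<comment> \<open>The constant term of the k-th derivative is k! times the coefficient of
    x_0^k.\<close>
  have h_large: "h k = 0" if "k \<ge> N" for k
    using arg_cong[OF N(1)[OF that], of "\<lambda>p. Poly_Mapping.lookup p 0"]
      arg_cong[OF N(2)[OF that], of "\<lambda>p. Poly_Mapping.lookup p 0"]
    by (simp add: lookup_sdiff_funpow h_def)
  have "h k = 0"
  \<comment> \<open>Downward induction on \<open>k\<close>: once all later values vanish, the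
    equation at \<open>k\<close> reduces to its summand \<open>n = 0\<close>.\<close>
  proof (induction "N - k" arbitrary: k rule: less_induct)
    case less
    show ?case
    proof (cases "k \<ge> N")
      case False
      have "h (k + n) = 0" if "n \<noteq> 0" for n
        using less[of "k + n"] h_large[of "k + n"] that False by (cases "k + n \<ge> N") auto
      then have "fps_nth duflo_root n * (fact (k + n) / fact k * h (k + n)) =
          (if n = 0 then h k else 0)" for n
        by (simp add: duflo_root_0)
      then show ?thesis
        using h_sum[of k] by (auto simp: N_def split: if_splits)
    qed (rule h_large)
  qed
  then show ?thesis by (simp add: h_def)
qed

text \<open>A representative in the free algebra of the coset \<open>symmetrization d c f\<close>,
  whose coefficients can be read off.\<close>

definition sym_tensor :: "'k::field_char_0 spoly \<Rightarrow> word \<Rightarrow>\<^sub>0 'k" where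
  "sym_tensor f = (\<Sum>u\<in>Poly_Mapping.keys f. let xs = monom_list u in
     \<Sum>\<sigma> | \<sigma> permutes {..<length xs}.
       Poly_Mapping.single (Word (permute_list \<sigma> xs)) (Poly_Mapping.lookup f u / fact (length xs)))"

lemma monom_list_single: "monom_list (Poly_Mapping.single i n) = replicate n i"
  by (cases "n = 0") (auto simp: monom_list_def)

lemma count_monom_list: "count (mset (monom_list u)) i = Poly_Mapping.lookup u i"
proof -
  have *: "count (mset (concat (map (\<lambda>i. replicate (Poly_Mapping.lookup u i) i) xs))) i =
      (if i \<in> set xs then Poly_Mapping.lookup u i else 0)" if "distinct xs" for xs
    using that by (induction xs) auto
  show ?thesis
    unfolding monom_list_def by (subst *) (auto simp: in_keys_iff)
qed

lemma monom_list_eq_replicate_iff: "monom_list u = replicate n i \<longleftrightarrow> u = Poly_Mapping.single i n"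
proof
  assume "monom_list u = replicate n i"
  then have "count (mset (monom_list u)) j = (if j = i then n else 0)" for j
    by simp
  then show "u = Poly_Mapping.single i n"
    by (intro poly_mapping_eqI) (auto simp: count_monom_list lookup_single when_def)
qed (simp add: monom_list_single)

lemma permute_list_eq_replicate_iff:
  assumes "\<sigma> permutes {..<length xs}"
  shows "permute_list \<sigma> xs = replicate n i \<longleftrightarrow> xs = replicate n i"
proof -
  have *: "ys = replicate n i \<longleftrightarrow> length ys = n \<and> set ys \<subseteq> {i}" for ys
    by (auto intro: replicate_eqI)
  show ?thesis
    unfolding * using assms by simp
qed

text \<open>Permuting letters gives a power of one letter only if the monomial is that power; then
  all \<open>fact k\<close> permutations give the same word and cancel the denominator.\<close>

lemma lookup_sym_tensor:
  "Poly_Mapping.lookup (sym_tensor f) (Word (replicate k i)) =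
     Poly_Mapping.lookup f (Poly_Mapping.single i k)"
proof -
  have "Poly_Mapping.lookup (let xs = monom_list u in
     \<Sum>\<sigma> | \<sigma> permutes {..<length xs}.
       Poly_Mapping.single (Word (permute_list \<sigma> xs)) (Poly_Mapping.lookup f u / fact (length xs)))
      (Word (replicate k i)) =
      (if u = Poly_Mapping.single i k then Poly_Mapping.lookup f u else 0)" for u
  proof -
    let ?xs = "monom_list u"
    have "Poly_Mapping.lookup (let xs = monom_list u in
     \<Sum>\<sigma> | \<sigma> permutes {..<length xs}.
       Poly_Mapping.single (Word (permute_list \<sigma> xs)) (Poly_Mapping.lookup f u / fact (length xs)))
      (Word (replicate k i)) = (\<Sum>\<sigma> | \<sigma> permutes {..<length ?xs}.
        if ?xs = replicate k i then Poly_Mapping.lookup f u / fact (length ?xs) else 0)"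
      unfolding Let_def lookup_sum lookup_single
      by (rule sum.cong) (auto simp: when_def permute_list_eq_replicate_iff)
    also have "\<dots> = (if u = Poly_Mapping.single i k then Poly_Mapping.lookup f u else 0)"
      by (auto simp: monom_list_eq_replicate_iff monom_list_single card_permutations[OF refl])
    finally show ?thesis .
  qed
  then show ?thesis
    by (simp add: sym_tensor_def lookup_sum sum.delta' in_keys_iff)
qed

lemma sym_tensor_single:
  "sym_tensor (Poly_Mapping.single (Poly_Mapping.single i n) r) =
     Poly_Mapping.single (Word (replicate n i)) r"
proof (cases "r = 0")
  case False
  have "sym_tensor (Poly_Mapping.single (Poly_Mapping.single i n) r) =
      (\<Sum>\<sigma> | \<sigma> permutes {..<n}. Poly_Mapping.single (Word (replicate n i)) (r / fact n))"
    using False permute_list_eq_replicate_iff[of _ "replicate n i" n i]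
    by (auto simp: sym_tensor_def monom_list_single intro!: sum.cong)
  also have "\<dots> = Poly_Mapping.single (Word (replicate n i)) r"
    unfolding sum_single_same by (simp add: card_permutations[OF refl])
  finally show ?thesis .
qed (simp add: sym_tensor_def)

section \<open>The free algebra as a ring and the ideal of the Lie relations\<close>

lemma uminus_tensor_ring:
  "a \<in> carrier (tensor_ring d) \<Longrightarrow> - a \<in> carrier (tensor_ring d)"
  by (auto simp: tensor_ring_def)

lemma ring_tensor_ring: "ring (tensor_ring d :: (word \<Rightarrow>\<^sub>0 'k::field_char_0) ring)"
  (is "ring ?R")
proof (rule ringI)
  show "abelian_group ?R"
  proof (rule abelian_groupI)
    fix a b assume "a \<in> carrier ?R" "b \<in> carrier ?R"
    then show "a \<oplus>\<^bsub>?R\<^esub> b \<in> carrier ?R"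
      using Poly_Mapping.keys_add[of a b] by (fastforce simp: tensor_ring_def)
  next
    fix a assume "a \<in> carrier ?R"
    then show "\<exists>b\<in>carrier ?R. b \<oplus>\<^bsub>?R\<^esub> a = \<zero>\<^bsub>?R\<^esub>"
      by (intro bexI[of _ "- a"]) (auto simp: tensor_ring_def)
  qed (simp_all add: tensor_ring_def add_ac)
  show "Group.monoid ?R"
  proof (rule monoidI)
    fix a b assume "a \<in> carrier ?R" "b \<in> carrier ?R"
    then show "a \<otimes>\<^bsub>?R\<^esub> b \<in> carrier ?R"
      using keys_mult[of a b] by (fastforce simp: tensor_ring_def plus_word_def)
  qed (auto simp: tensor_ring_def mult.assoc zero_word_def)
qed (simp_all add: tensor_ring_def algebra_simps)

lemma a_inv_tensor_ring:
  assumes "a \<in> carrier (tensor_ring d)"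
  shows "\<ominus>\<^bsub>tensor_ring d\<^esub> a = - a"
proof -
  interpret ring "tensor_ring d" by (rule ring_tensor_ring)
  show ?thesis
    using assms uminus_tensor_ring[OF assms]
    by (intro minus_equality) (simp_all add: tensor_ring_def)
qed

lemma lie_relations_carrier: "lie_relations d c \<subseteq> carrier (tensor_ring d)"
proof
  interpret ring "tensor_ring d" by (rule ring_tensor_ring)
  fix a assume "a \<in> lie_relations d c"
  then obtain i j where ij: "i < d" "j < d" and a: "a = Poly_Mapping.single (Word [i, j]) 1 -
      Poly_Mapping.single (Word [j, i]) 1 - (\<Sum>k<d. Poly_Mapping.single (Word [k]) (c i j k))"
    by (auto simp: lie_relations_def)
  have minus: "x - y \<in> carrier (tensor_ring d)"
    if "x \<in> carrier (tensor_ring d)" "y \<in> carrier (tensor_ring d)" for x y :: "word \<Rightarrow>\<^sub>0 'a"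
    using that keys_diff[of x y] by (fastforce simp: tensor_ring_def)
  have sum: "(\<Sum>k\<in>A. f k) \<in> carrier (tensor_ring d)"
    if "\<And>k. k \<in> A \<Longrightarrow> f k \<in> carrier (tensor_ring d)" for A and f :: "nat \<Rightarrow> word \<Rightarrow>\<^sub>0 'a"
    using that keys_sum[of f A] by (fastforce simp: tensor_ring_def)
  show "a \<in> carrier (tensor_ring d)"
    unfolding a using ij by (intro minus sum) (auto simp: tensor_ring_def)
qed

text \<open>Setting \<open>x\<^sub>1 = 0\<close> is a homomorphism from the enveloping algebra onto \<open>\<bbbK>[x\<^sub>0]\<close>; it is encoded by
  the coefficients of the words \<open>x\<^sub>0\<^sup>k\<close> and replaces the Poincare--Birkhoff--Witt theorem.\<close>

lemma lie_ideal_aff1_lookup: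
  assumes "a \<in> lie_ideal 2 (aff1 :: nat \<Rightarrow> nat \<Rightarrow> nat \<Rightarrow> 'k::field_char_0)"
  shows "Poly_Mapping.lookup a (Word (replicate k 0)) = 0"
proof -
  let ?R = "tensor_ring 2 :: (word \<Rightarrow>\<^sub>0 'k) ring"
  \<comment> \<open>The kernel of the homomorphism from the free algebra that sends x_1 to 0; it is
    shown to be an ideal containing the relations.\<close>
  define K where "K = {a \<in> carrier ?R. \<forall>k. Poly_Mapping.lookup a (Word (replicate k 0)) = 0}"
  interpret ring ?R by (rule ring_tensor_ring)
  \<comment> \<open>A power of x_0 factors only into powers of x_0. This makes \<open>K\<close>
    absorb products from both sides.\<close>
  have split: "\<exists>i j. l = Word (replicate i 0) \<and> q = Word (replicate j 0)"
    if "Word (replicate k 0) = l + q" for k l q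
  proof -
    have "letters l @ letters q = replicate k 0"
      using that by (simp add: plus_word_def)
    then have "set (letters l) \<subseteq> {0}" "set (letters q) \<subseteq> {0}"
      by (metis Un_subset_iff set_append set_replicate_conv_if subset_refl empty_subsetI)+
    then have "letters l = replicate (length (letters l)) 0" "letters q = replicate (length (letters q)) 0"
      by (auto simp: replicate_length_same subset_iff)
    then show ?thesis by (metis word.collapse)
  qed
  have mult: "Poly_Mapping.lookup (a * b) (Word (replicate k 0)) = 0"
    if "(\<forall>k. Poly_Mapping.lookup a (Word (replicate k 0)) = 0) \<or>
      (\<forall>k. Poly_Mapping.lookup b (Word (replicate k 0)) = 0)" for a b :: "word \<Rightarrow>\<^sub>0 'k" and k
  proof -
    have that_zero: "Poly_Mapping.lookup a l * (Poly_Mapping.lookup b q when Word (replicate k 0) = l + q) = 0" for l q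
      using that split[of k l q] by (auto simp: when_def)
    have "Poly_Mapping.lookup a l * (\<Sum>q. Poly_Mapping.lookup b q when Word (replicate k 0) = l + q) = 0" for l
    proof (cases "Poly_Mapping.lookup a l = 0")
      case False
      with that_zero have eq: "(\<lambda>q. Poly_Mapping.lookup b q when Word (replicate k 0) = l + q) = (\<lambda>_. 0)"
        by (metis (mono_tags, lifting) mult_eq_0_iff)
      show ?thesis unfolding eq by simp
    qed simp
    then show ?thesis
      by (simp only: lookup_mult Sum_any.neutral)
  qed
  have "ideal K ?R"
  proof (rule idealI)
    show "subgroup K (add_monoid ?R)"
    proof (rule subgroup.intro)
      fix a assume a: "a \<in> K"
      then have "inv\<^bsub>add_monoid ?R\<^esub> a = - a"
        using a_inv_tensor_ring[of a 2] by (simp add: K_def a_inv_def)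
      with a show "inv\<^bsub>add_monoid ?R\<^esub> a \<in> K"
        using uminus_tensor_ring[of a 2] by (simp add: K_def)
    next
      fix a b assume ab: "a \<in> K" "b \<in> K"
      then have "a \<oplus>\<^bsub>?R\<^esub> b \<in> carrier ?R"
        by (simp add: K_def)
      with ab show "a \<otimes>\<^bsub>add_monoid ?R\<^esub> b \<in> K"
        by (simp add: K_def) (simp add: tensor_ring_def lookup_add)
    next
      have "\<zero>\<^bsub>?R\<^esub> \<in> carrier ?R" by simp
      then show "\<one>\<^bsub>add_monoid ?R\<^esub> \<in> K"
        by (simp add: K_def) (simp add: tensor_ring_def)
    qed (auto simp: K_def)
  next
    fix a x assume ax: "a \<in> K" "x \<in> carrier ?R"
    then have "x \<otimes>\<^bsub>?R\<^esub> a \<in> carrier ?R" "a \<otimes>\<^bsub>?R\<^esub> x \<in> carrier ?R"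
      by (simp_all add: K_def)
    with ax mult show "x \<otimes>\<^bsub>?R\<^esub> a \<in> K" "a \<otimes>\<^bsub>?R\<^esub> x \<in> K"
      by (simp_all add: K_def) (simp_all add: tensor_ring_def)
  qed (rule ring_axioms)
  moreover have "lie_relations 2 aff1 \<subseteq> K"
  proof
    fix a :: "word \<Rightarrow>\<^sub>0 'k" assume rel: "a \<in> lie_relations 2 aff1"
    then obtain i j where ij: "i < 2" "j < 2" and a: "a = Poly_Mapping.single (Word [i, j]) 1 -
        Poly_Mapping.single (Word [j, i]) 1 - (\<Sum>k<2. Poly_Mapping.single (Word [k]) (aff1 i j k))"
      by (auto simp: lie_relations_def)
    have "a \<in> carrier ?R"
      using rel lie_relations_carrier by blast
    moreover have "Poly_Mapping.lookup a (Word (replicate k 0)) = 0" for k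
      using ij by (auto simp: a lookup_minus lookup_sum lookup_single when_def numeral_2_eq_2
          less_Suc_eq aff1_def Cons_replicate_eq)
    ultimately show "a \<in> K" by (simp add: K_def)
  qed
  ultimately have "lie_ideal 2 aff1 \<subseteq> K"
    unfolding lie_ideal_def by (rule genideal_minimal)
  with assms show ?thesis by (auto simp: K_def)
qed

lemma ideal_lie_ideal:
  assumes "lie_relations d c \<subseteq> carrier (tensor_ring d)"
  shows "ideal (lie_ideal d c) (tensor_ring d)"
  unfolding lie_ideal_def using assms by (rule ring.genideal_ideal[OF ring_tensor_ring])

text \<open>Here \<open>h\<close> is a candidate for the Duflo product of \<open>f\<close> and
  \<open>g\<close>. \<open>duflo_mult\<close> takes some preimage under the Duflo map, which could a
  priori differ from \<open>h\<close>. The image determines the coefficients of all powers of x_0,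
  hence the constant terms agree.\<close>

lemma lookup_duflo_mult_aff1:
  fixes f g h :: "'k::field_char_0 spoly"
  assumes h: "h \<in> sym_alg 2"
    and carrier: "sym_tensor (J_half_op 2 aff1 f) \<in> carrier (tensor_ring 2)"
      "sym_tensor (J_half_op 2 aff1 g) \<in> carrier (tensor_ring 2)"
    and mult: "sym_tensor (J_half_op 2 aff1 f) * sym_tensor (J_half_op 2 aff1 g) =
      sym_tensor (J_half_op 2 aff1 h)"
  shows "Poly_Mapping.lookup (duflo_mult 2 aff1 f g) 0 = Poly_Mapping.lookup h 0"
proof -
  let ?R = "tensor_ring 2 :: (word \<Rightarrow>\<^sub>0 'k) ring" and ?I = "lie_ideal 2 (aff1 :: nat \<Rightarrow> nat \<Rightarrow> nat \<Rightarrow> 'k)"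
  interpret ring ?R by (rule ring_tensor_ring)
  interpret I: ideal ?I ?R by (rule ideal_lie_ideal[OF lie_relations_carrier])
  have duflo: "duflo 2 aff1 p = ?I +>\<^bsub>?R\<^esub> sym_tensor (J_half_op 2 aff1 p)" for p :: "'k spoly"
    by (simp add: duflo_def symmetrization_def sym_tensor_def)
  define h' where "h' = duflo_mult 2 aff1 f g"
  have "duflo 2 aff1 f \<otimes>\<^bsub>enveloping_algebra 2 aff1\<^esub> duflo 2 aff1 g = duflo 2 aff1 h"
    using I.rcoset_mult_add[OF carrier] mult
    by (simp add: duflo enveloping_algebra_def FactRing_def) (simp add: tensor_ring_def)
  \<comment> \<open>\<open>inv_into\<close> yields a genuine preimage because \<open>h\<close> is
    one inside \<open>sym_alg 2\<close>.\<close>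
  then have "duflo 2 aff1 h' = duflo 2 aff1 h"
    unfolding h'_def duflo_mult_def using h by (simp add: f_inv_into_f)
  moreover have "sym_tensor (J_half_op 2 aff1 h') \<in> duflo 2 aff1 h'"
    unfolding duflo a_r_coset_def' using additive_subgroup.zero_closed[OF I.is_additive_subgroup]
    by (auto simp: tensor_ring_def)
  ultimately obtain a where a: "a \<in> ?I"
    "sym_tensor (J_half_op 2 aff1 h') = a + sym_tensor (J_half_op 2 aff1 h)"
    unfolding duflo a_r_coset_def' by (auto simp: tensor_ring_def)
  have "Poly_Mapping.lookup (J_half_op 2 aff1 h') (Poly_Mapping.single 0 k) =
      Poly_Mapping.lookup (J_half_op 2 aff1 h) (Poly_Mapping.single 0 k)" for k
    using arg_cong[OF a(2), of "\<lambda>p. Poly_Mapping.lookup p (Word (replicate k 0))"]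
      lie_ideal_aff1_lookup[OF a(1), of k]
    by (simp add: lookup_add lookup_sym_tensor)
  then have "Poly_Mapping.lookup h' (Poly_Mapping.single 0 0) =
      Poly_Mapping.lookup h (Poly_Mapping.single 0 0)"
    by (rule J_half_op_aff1_inj)
  then show ?thesis by (simp add: h'_def)
qed

section \<open>Explicit Duflo products of scalars and generators\<close>

lemma sdiff_funpow_0: "(sdiff i ^^ n) 0 = 0"
  by (induction n) (simp_all add: sdiff_def)

lemma J_half_op_aff1_sconst: "J_half_op 2 aff1 (sconst r) = sconst r"
proof -
  have "(sdiff 0 ^^ n) (sconst r :: 'a spoly) = 0" if "n \<ge> 1" for n
    using that by (cases n) (simp_all add: funpow_Suc_right sconst_def sdiff_single sdiff_funpow_0 del: funpow.simps(2))
  then show ?thesis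
    by (subst J_half_op_aff1[of 1]) (simp_all add: duflo_root_0 sconst_def mult_single)
qed

lemma sdiff_0: "sdiff i 0 = 0"
  by (simp add: sdiff_def)

lemma sdiff_sconst: "sdiff i (sconst r) = 0"
  by (simp add: sconst_def sdiff_single)

lemma sdiff_svar: "sdiff i (svar j) = (if i = j then 1 else 0)"
  by (auto simp: svar_def sdiff_single lookup_single when_def)

lemma sdiff_1: "sdiff i 1 = 0"
  using sdiff_single[of i 0 1] by simp

lemma J_half_op_aff1_svar: "J_half_op 2 aff1 (svar i) = svar i"
proof -
  have "(sdiff 0 ^^ n) (svar i :: 'a spoly) = 0" if "n \<ge> 2" for n
  proof -
    from le_Suc_ex[OF that] obtain m where "n = Suc (Suc m)"
      by auto
    then show ?thesis
      by (simp add: funpow_Suc_right sdiff_svar sdiff_1 sdiff_funpow_0 sdiff_0 del: funpow.simps(2))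
  qed
  then show ?thesis
    by (subst J_half_op_aff1[of 2])
      (simp_all add: duflo_root_0 duflo_root_1[simplified] sconst_def mult_single numeral_2_eq_2)
qed

text \<open>The quadratic coefficient 1/48 meets the second derivative 2 of x_0^2; subtracting 1/24
  compensates for it.\<close>

lemma J_half_op_aff1_square:
  "J_half_op 2 aff1 (svar 0 ^ 2 - sconst (1 / 24)) = (svar 0 ^ 2 :: 'k::field_char_0 spoly)"
proof -
  define f where "f = (svar 0 ^ 2 - sconst (1 / 24) :: 'k spoly)"
  have d1: "sdiff 0 f = Poly_Mapping.single (Poly_Mapping.single 0 1) 2"
    by (simp add: f_def svar_power sconst_def sdiff_diff sdiff_single flip: single_diff)
  have d2: "sdiff 0 (sdiff 0 f) = sconst 2"
    unfolding d1 by (simp add: sdiff_single sconst_def)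
  have d3: "sdiff 0 (sdiff 0 (sdiff 0 f)) = 0"
    unfolding d2 by (simp add: sdiff_single sconst_def)
  have zero: "(sdiff 0 ^^ n) f = 0" if "n \<ge> 3" for n
  proof -
    from le_Suc_ex[OF that] obtain m where n: "n = m + Suc (Suc (Suc 0))"
      by auto
    have "(sdiff 0 ^^ n) f = (sdiff 0 ^^ m) (sdiff 0 (sdiff 0 (sdiff 0 f)))"
      unfolding n funpow_add by simp
    then show ?thesis
      by (simp only: d3 sdiff_funpow_0)
  qed
  have "J_half_op 2 aff1 f = (\<Sum>n<3. sconst (fps_nth duflo_root n) * (sdiff 0 ^^ n) f)"
    by (rule J_half_op_aff1) (rule zero)
  also have "\<dots> = sconst 1 * f + sconst 0 * sdiff 0 f + sconst (1 / 48) * sdiff 0 (sdiff 0 f)"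
    unfolding numeral_3_eq_3 sum.lessThan_Suc
    by (simp add: duflo_root_0 duflo_root_1[simplified] duflo_root_2[unfolded numeral_2_eq_2])
  also have "\<dots> = svar 0 ^ 2"
    unfolding d2 by (simp add: f_def sconst_def mult_single)
  finally show ?thesis
    unfolding f_def .
qed

lemma single_word_carrier:
  "set ws \<subseteq> {..<d} \<Longrightarrow> Poly_Mapping.single (Word ws) r \<in> carrier (tensor_ring d)"
  by (auto simp: tensor_ring_def)

lemma sym_tensor_sconst: "sym_tensor (sconst r) = Poly_Mapping.single 0 r"
  using sym_tensor_single[of 0 0 r] by (simp add: sconst_def zero_word_def)

lemma sym_tensor_svar: "sym_tensor (svar i) = Poly_Mapping.single (Word [i]) 1"
  using sym_tensor_single[of i 1 1] by (simp add: svar_def)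

lemma lookup_sconst: "Poly_Mapping.lookup (sconst r) 0 = r"
  by (simp add: sconst_def)

lemma sconst_sym_alg: "sconst r \<in> sym_alg d"
  by (auto simp: sym_alg_def sconst_def split: if_splits)

lemma duflo_mult_aff1_sconst:
  "Poly_Mapping.lookup (duflo_mult 2 aff1 (sconst r) (sconst s)) 0 = r * s"
  using lookup_duflo_mult_aff1[of "sconst (r * s)" "sconst r" "sconst s"]
  by (simp add: J_half_op_aff1_sconst sym_tensor_sconst sconst_sym_alg lookup_sconst mult_single
      zero_word_def plus_word_def single_word_carrier)

lemma sdiff_sconst_mult: "sdiff i (sconst r * f) = sconst r * sdiff i f"
  by (rule poly_mapping_eqI) (simp add: lookup_sdiff lookup_sconst_mult)

lemma J_half_op_aff1_scaled_svar: "J_half_op 2 aff1 (sconst r * svar i) = sconst r * svar i"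
proof -
  have "(sdiff 0 ^^ n) (sconst r * svar i :: 'a spoly) = 0" if "n \<ge> 2" for n
  proof -
    from le_Suc_ex[OF that] obtain m where "n = Suc (Suc m)"
      by auto
    then show ?thesis
      by (cases "i = 0") (simp_all add: funpow_Suc_right sdiff_sconst_mult sdiff_svar sdiff_1
          sdiff_sconst sdiff_funpow_0 sdiff_0 del: funpow.simps(2))
  qed
  then show ?thesis
    by (subst J_half_op_aff1[of 2])
      (simp_all add: duflo_root_0 duflo_root_1[simplified] numeral_2_eq_2 sdiff_sconst_mult sconst_def)
qed

lemma sym_tensor_scaled_svar: "sym_tensor (sconst r * svar i) = Poly_Mapping.single (Word [i]) r"
  using sym_tensor_single[of i 1 r] by (simp add: svar_def sconst_def mult_single)

lemma sconst_svar_sym_alg: "i < d \<Longrightarrow> sconst r * svar i \<in> sym_alg d"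
  by (auto simp: sconst_def svar_def mult_single sym_alg_def split: if_splits)

lemma lookup_svar_power_0: "n \<noteq> 0 \<Longrightarrow> Poly_Mapping.lookup (svar i ^ n) 0 = 0"
  by (auto simp: svar_power lookup_single when_def poly_mapping_eq_iff fun_eq_iff)

lemma lookup_svar_0: "Poly_Mapping.lookup (svar i) 0 = 0"
  using lookup_svar_power_0[of 1 i] by simp

lemma duflo_mult_aff1_sconst_svar:
  assumes "i < 2"
  shows "Poly_Mapping.lookup (duflo_mult 2 aff1 (sconst r) (svar i)) 0 = 0"
    and "Poly_Mapping.lookup (duflo_mult 2 aff1 (svar i) (sconst r)) 0 = 0"
  using assms
    lookup_duflo_mult_aff1[of "sconst r * svar i" "sconst r" "svar i"]
    lookup_duflo_mult_aff1[of "sconst r * svar i" "svar i" "sconst r"]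
  by (simp_all add: J_half_op_aff1_sconst J_half_op_aff1_svar J_half_op_aff1_scaled_svar
      sym_tensor_sconst sym_tensor_svar sym_tensor_scaled_svar sconst_svar_sym_alg mult_single
      zero_word_def plus_word_def single_word_carrier lookup_sconst_mult lookup_svar_0)

text \<open>In the enveloping algebra the square of x_0 is the symmetrization of x_0^2, which is the
  Duflo image of x_0^2 - 1/24. This is the source of the number in the final contradiction.\<close>

lemma duflo_mult_aff1_svar_svar:
  "Poly_Mapping.lookup (duflo_mult 2 aff1 (svar 0) (svar 0)) 0 = (- 1 / 24 :: 'k::field_char_0)"
proof -
  have "sym_tensor (svar 0 ^ 2 :: 'k spoly) = sym_tensor (svar 0) * sym_tensor (svar 0)"
    unfolding svar_power sym_tensor_single
    by (simp add: sym_tensor_svar mult_single plus_word_def numeral_2_eq_2)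
  moreover have "svar 0 ^ 2 - sconst (1 / 24) \<in> (sym_alg 2 :: 'k spoly set)"
    unfolding sym_alg_def
    using keys_diff[of "svar 0 ^ 2 :: 'k spoly" "sconst (1 / 24)"]
    by (fastforce simp: svar_power sconst_def split: if_splits)
  moreover have "Poly_Mapping.lookup (svar 0 ^ 2 - sconst (1 / 24)) 0 = (- 1 / 24 :: 'k)"
    by (simp add: lookup_svar_power_0 lookup_minus lookup_sconst)
  ultimately show ?thesis
    using lookup_duflo_mult_aff1[of "svar 0 ^ 2 - sconst (1 / 24) :: 'k spoly" "svar 0" "svar 0"]
    by (simp add: J_half_op_aff1_square J_half_op_aff1_svar sym_tensor_svar single_word_carrier)
qed

section \<open>Constant terms and polynomial degrees in \<open>A\<close>\<close>

definition const_part :: "'k::field_char_0 sext \<Rightarrow> 'k" where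
  "const_part a = Poly_Mapping.lookup (Poly_Mapping.lookup a {}) 0"

lemma const_part_0 [simp]: "const_part 0 = 0"
  by (simp add: const_part_def)

lemma const_part_add: "const_part (a + b) = const_part a + const_part b"
  by (simp add: const_part_def lookup_add)

lemma const_part_diff: "const_part (a - b) = const_part a - const_part b"
  by (simp add: const_part_def lookup_minus)

lemma const_part_sum: "const_part (sum f A) = (\<Sum>x\<in>A. const_part (f x))"
  by (simp add: const_part_def lookup_sum)

lemma lookup_sext_scale:
  "Poly_Mapping.lookup (sext_scale r a) I = sconst r * Poly_Mapping.lookup a I"
  by (simp add: sext_scale_def Poly_Mapping.map.rep_eq when_def)

lemma const_part_scale: "const_part (sext_scale r a) = r * const_part a"
  by (simp add: const_part_def lookup_sext_scale lookup_sconst_mult)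

lemma const_part_single:
  "const_part (Poly_Mapping.single I f) = (if I = {} then Poly_Mapping.lookup f 0 else 0)"
  by (simp add: const_part_def lookup_single when_def)

lemma monom_add_eq_0_iff: "0 = u + v \<longleftrightarrow> u = 0 \<and> v = (0 :: nat \<Rightarrow>\<^sub>0 nat)"
  by (auto simp: poly_mapping_eq_iff lookup_add fun_eq_iff)

lemma lookup_spoly_mult_0:
  "Poly_Mapping.lookup (f * g :: 'k::field_char_0 spoly) 0 = Poly_Mapping.lookup f 0 * Poly_Mapping.lookup g 0"
proof -
  have "(\<Sum>q. Poly_Mapping.lookup g q when 0 = l + q) = (Poly_Mapping.lookup g 0 when l = 0)" for l
    by (cases "l = 0") (simp_all add: monom_add_eq_0_iff when_def)
  then show ?thesis
    by (simp add: lookup_mult mult_when)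
qed

text \<open>The case distinction is there because \<open>sext_mult\<close> sums over nonzero
  components: a vanishing component contributes 0 whatever value \<open>mS\<close> takes at
  0.\<close>

lemma const_part_mult_gen:
  "const_part (sext_mult mS a b) =
     (if Poly_Mapping.lookup a {} = 0 \<or> Poly_Mapping.lookup b {} = 0 then 0
      else Poly_Mapping.lookup (mS (Poly_Mapping.lookup a {}) (Poly_Mapping.lookup b {})) 0)"
proof -
  have "const_part (sext_mult mS a b) = (\<Sum>I\<in>Poly_Mapping.keys a. if I = {} then
      (\<Sum>J\<in>Poly_Mapping.keys b. if J = {} then
        Poly_Mapping.lookup (mS (Poly_Mapping.lookup a I) (Poly_Mapping.lookup b J)) 0 else 0) else 0)"
    unfolding sext_mult_def const_part_sum const_part_single
    by (intro sum.cong refl)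
      (auto intro!: sum.cong sum.neutral simp: wedge_sign_def lookup_sconst_mult)
  also have "\<dots> = (if Poly_Mapping.lookup a {} = 0 \<or> Poly_Mapping.lookup b {} = 0 then 0
      else Poly_Mapping.lookup (mS (Poly_Mapping.lookup a {}) (Poly_Mapping.lookup b {})) 0)"
    by (auto simp: in_keys_iff)
  finally show ?thesis .
qed

lemma const_part_mult: "const_part (sext_mult (*) a b) = const_part a * const_part b"
  by (simp add: const_part_mult_gen lookup_spoly_mult_0) (auto simp: const_part_def)

section \<open>The polynomial degree in the variables x_i\<close>

definition xdeg :: "(nat \<Rightarrow>\<^sub>0 nat) \<Rightarrow> nat" where
  "xdeg u = (\<Sum>i\<in>Poly_Mapping.keys u. Poly_Mapping.lookup u i)"

lemma xdeg_superset:
  assumes "finite S" "Poly_Mapping.keys u \<subseteq> S"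
  shows "xdeg u = (\<Sum>i\<in>S. Poly_Mapping.lookup u i)"
  unfolding xdeg_def using assms by (intro sum.mono_neutral_left) (auto simp: in_keys_iff)

lemma xdeg_0 [simp]: "xdeg 0 = 0"
  by (simp add: xdeg_def)

lemma xdeg_add: "xdeg (u + v) = xdeg u + xdeg v"
proof -
  let ?S = "Poly_Mapping.keys u \<union> Poly_Mapping.keys v"
  have "xdeg (u + v) = (\<Sum>i\<in>?S. Poly_Mapping.lookup (u + v) i)"
    using Poly_Mapping.keys_add[of u v] by (intro xdeg_superset) auto
  also have "\<dots> = (\<Sum>i\<in>?S. Poly_Mapping.lookup u i) + (\<Sum>i\<in>?S. Poly_Mapping.lookup v i)"
    by (simp add: lookup_add sum.distrib)
  also have "\<dots> = xdeg u + xdeg v"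
    by (simp add: xdeg_superset[of ?S])
  finally show ?thesis .
qed

lemma xdeg_single: "xdeg (Poly_Mapping.single i n) = n"
  by (simp add: xdeg_def)

text \<open>The degree is an integer so that degree counts may become negative; the space is then 0,
  which cuts off infinite sums of graphs.\<close>

definition shom :: "int \<Rightarrow> 'k::field_char_0 spoly set" where
  "shom e = {f. \<forall>u\<in>Poly_Mapping.keys f. int (xdeg u) = e}"

definition xhom :: "int \<Rightarrow> 'k::field_char_0 sext set" where
  "xhom e = {a. \<forall>I. Poly_Mapping.lookup a I \<in> shom e}"

lemma shom_0: "0 \<in> shom e"
  by (simp add: shom_def)

lemma shom_sum: "(\<And>x. x \<in> A \<Longrightarrow> f x \<in> shom e) \<Longrightarrow> sum f A \<in> shom e"
  using keys_sum[of f A] by (fastforce simp: shom_def)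

lemma shom_mult: "f \<in> shom e \<Longrightarrow> g \<in> shom e' \<Longrightarrow> f * g \<in> shom (e + e')"
  using keys_mult[of f g] by (fastforce simp: shom_def xdeg_add)

lemma shom_sconst: "sconst r \<in> shom 0"
  by (auto simp: shom_def sconst_def split: if_splits)

lemma shom_sconst_mult: "f \<in> shom e \<Longrightarrow> sconst r * f \<in> shom e"
  using shom_mult[OF shom_sconst] by fastforce

lemma shom_sdiff:
  assumes "f \<in> shom e"
  shows "sdiff i f \<in> shom (e - 1)"
proof -
  have "int (xdeg u) = e - 1" if "u \<in> Poly_Mapping.keys (sdiff i f)" for u
  proof -
    have "u + Poly_Mapping.single i 1 \<in> Poly_Mapping.keys f"
      using that by (auto simp: in_keys_iff lookup_sdiff)
    then have "int (xdeg (u + Poly_Mapping.single i 1)) = e"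
      using assms by (auto simp: shom_def)
    then show ?thesis
      by (simp add: xdeg_add xdeg_single)
  qed
  then show ?thesis by (simp add: shom_def)
qed

lemma xhom_0: "0 \<in> xhom e"
  by (simp add: xhom_def shom_0)

lemma xhom_sum: "(\<And>x. x \<in> A \<Longrightarrow> f x \<in> xhom e) \<Longrightarrow> sum f A \<in> xhom e"
  by (auto simp: xhom_def lookup_sum intro: shom_sum)

lemma xhom_single: "f \<in> shom e \<Longrightarrow> Poly_Mapping.single I f \<in> xhom e"
  by (auto simp: xhom_def lookup_single when_def shom_0)

lemma xhom_scale: "a \<in> xhom e \<Longrightarrow> sext_scale r a \<in> xhom e"
  by (auto simp: xhom_def lookup_sext_scale intro: shom_sconst_mult)

lemma xhom_mult: "a \<in> xhom e \<Longrightarrow> b \<in> xhom e' \<Longrightarrow> sext_mult (*) a b \<in> xhom (e + e')"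
  unfolding sext_mult_def
  by (intro xhom_sum xhom_single shom_sconst_mult shom_mult) (auto simp: xhom_def)

lemma xhom_dx: "a \<in> xhom e \<Longrightarrow> sext_dx l a \<in> xhom (e - 1)"
  by (auto simp: xhom_def sext_dx_def Poly_Mapping.map.rep_eq when_def intro: shom_sdiff shom_0)

lemma xhom_sign: "f \<in> shom e \<Longrightarrow> (- 1) ^ n * f \<in> shom e"
  by (cases "even n") (auto simp: shom_def)

lemma xhom_dp: "a \<in> xhom e \<Longrightarrow> sext_dp l a \<in> xhom e"
  unfolding sext_dp_def by (intro xhom_sum xhom_single xhom_sign) (auto simp: xhom_def)

lemma xhom_inv: "a \<in> xhom e \<Longrightarrow> sext_inv a \<in> xhom e"
  unfolding sext_inv_def by (intro xhom_sum xhom_single xhom_sign) (auto simp: xhom_def)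

lemma xhom_one: "Poly_Mapping.single {} 1 \<in> xhom 0"
  by (intro xhom_single) (use shom_sconst[of 1] in \<open>simp add: sconst_def\<close>)

lemma xhom_neg:
  assumes "a \<in> xhom e" "e < 0"
  shows "a = 0"
proof -
  have "Poly_Mapping.keys (Poly_Mapping.lookup a I) = {}" for I
    using assms by (force simp: xhom_def shom_def)
  then show ?thesis
    by (intro poly_mapping_eqI) simp
qed

lemma const_part_xhom: "a \<in> xhom e \<Longrightarrow> e \<noteq> 0 \<Longrightarrow> const_part a = 0"
  by (force simp: xhom_def shom_def const_part_def in_keys_iff)

lemma xhom_foldr:
  "list_all2 (\<lambda>e t. t \<in> xhom e) es ts \<Longrightarrow>
     foldr (sext_mult (*)) ts (Poly_Mapping.single {} 1) \<in> xhom (sum_list es)"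
  by (induction rule: list_all2_induct) (auto intro: xhom_one xhom_mult)

lemma sum_list_update_int:
  "k < length xs \<Longrightarrow> sum_list (xs[k := x]) = sum_list xs + x - (xs ! k :: int)"
  by (induction xs arbitrary: k) (auto split: nat.split)

text \<open>Each edge differentiates its target once by some x_l. Its other effects,
  \<partial>/\<partial>p^l and signs, preserve the degree in the x_i, and the final product adds
  degrees.\<close>

lemma xhom_apply_edges:
  "list_all2 (\<lambda>e t. t \<in> xhom e) es ts \<Longrightarrow> \<forall>(i, j)\<in>set E. j < length ts \<Longrightarrow>
     apply_edges d E ts \<in> xhom (sum_list es - int (length E))"
proof (induction E arbitrary: es ts)
  case Nil
  then show ?case by (simp add: xhom_foldr)
next
  case (Cons ij E)
  obtain i j where ij: "ij = (i, j)" by (cases ij)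
  have len: "length es = length ts"
    using Cons.prems(1) by (rule list_all2_lengthD)
  have "apply_edges d E (tau_summand l i j ts) \<in> xhom (sum_list es - int (length (ij # E)))" for l
  proof -
    let ?es = "es[j := es ! j - 1]"
    have "list_all2 (\<lambda>e t. t \<in> xhom e) ?es (tau_summand l i j ts)"
      using Cons.prems(1) len
      by (auto simp: list_all2_conv_all_nth tau_summand_def Let_def nth_list_update
          intro: xhom_dx xhom_dp xhom_inv)
    from Cons.IH[OF this]
    have "apply_edges d E (tau_summand l i j ts) \<in> xhom (sum_list ?es - int (length E))"
      using Cons.prems(2) by (simp add: tau_summand_def)
    also have "sum_list ?es - int (length E) = sum_list es - int (length (ij # E))"
      using Cons.prems(2) len ij by (simp add: sum_list_update_int)
    finally show ?thesis .
  qed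
  then show ?case
    by (simp add: ij xhom_sum)
qed

lemma xhom_pi: "lie_pi d c \<in> xhom 1"
proof -
  have p: "sext_p i \<in> xhom 0" for i
    unfolding sext_p_def by (intro xhom_single) (use shom_sconst[of 1] in \<open>simp add: sconst_def\<close>)
  have x: "sext_x i \<in> xhom 1" for i
    unfolding sext_x_def by (intro xhom_single) (auto simp: shom_def svar_def xdeg_single)
  have "sext_mult (*) (sext_x k) (sext_mult (*) (sext_p i) (sext_p j)) \<in> xhom (1 + (0 + 0))" for i j k
    by (intro xhom_mult p x)
  then show ?thesis
    unfolding lie_pi_def by (intro xhom_sum xhom_scale) simp
qed

section \<open>Sums of graphs as multilinear maps\<close>

fun edge_positions :: "dgraph \<Rightarrow> (nat \<times> nat) list" where
  "edge_positions (m, es) = map (map_prod (position m) (position m)) es"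

lemma edge_positions_admissible:
  assumes "admissible n (m, es)"
  shows "set (edge_positions (m, es)) \<subseteq> {(i, j). i < m + n \<and> j < m + n \<and> i \<noteq> j}"
    and "distinct (edge_positions (m, es))"
proof -
  have sub: "set es \<subseteq> vertices n m \<times> vertices n m" and "distinct es" "\<forall>(u, v)\<in>set es. u \<noteq> v"
    using assms by auto
  have inj: "inj_on (position m) (vertices n m)"
    by (auto simp: inj_on_def vertices_def)
  have bound: "position m v < m + n" if "v \<in> vertices n m" for v
    using that by (auto simp: vertices_def)
  show "set (edge_positions (m, es)) \<subseteq> {(i, j). i < m + n \<and> j < m + n \<and> i \<noteq> j}"
  proof
    fix ij assume "ij \<in> set (edge_positions (m, es))"
    then obtain u v where uv: "(u, v) \<in> set es" "ij = (position m u, position m v)"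
      by auto
    then have "u \<in> vertices n m" "v \<in> vertices n m" "u \<noteq> v"
      using sub \<open>\<forall>(u, v)\<in>set es. u \<noteq> v\<close> by auto
    then show "ij \<in> {(i, j). i < m + n \<and> j < m + n \<and> i \<noteq> j}"
      using uv inj bound by (auto dest: inj_onD)
  qed
  have "inj_on (map_prod (position m) (position m)) (set es)"
    using map_prod_inj_on[OF inj inj] sub inj_on_subset by blast
  then show "distinct (edge_positions (m, es))"
    using \<open>distinct es\<close> by (simp add: distinct_map)
qed

lemma B_graph_edge_positions:
  "B_graph d c (m, es) fs = apply_edges d (edge_positions (m, es)) (replicate m (lie_pi d c) @ fs)"
  by simp

lemma module_dgraph_scale: "Modules.module (dgraph_scale :: 'k::field_char_0 \<Rightarrow> _)"
proof -
  have "Poly_Mapping.lookup (dgraph_scale r a) G = r * Poly_Mapping.lookup a G" for r :: 'k and a G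
    by (simp add: dgraph_scale_def Poly_Mapping.map.rep_eq when_def)
  then show ?thesis
    by unfold_locales (auto intro!: poly_mapping_eqI simp: lookup_add algebra_simps)
qed

text \<open>\<open>B_class\<close> evaluates a chosen representative. The class contains the chain
  that defines it, so the choice is made from a nonempty set of chains with the same
  \<open>n\<close>, \<open>m\<close> and degree.\<close>

lemma some_mem_dgraph_chains:
  assumes "X \<in> dgraphs n m k"
  shows "(SOME a. a \<in> X) \<in> dgraph_chains n m k"
proof -
  have "\<exists>a. a \<in> X"
    using assms module.span_zero[OF module_dgraph_scale] by (force simp: dgraphs_def)
  then have "(SOME a. a \<in> X) \<in> X" by (rule someI_ex)
  then show ?thesis using assms by (auto simp: dgraphs_def)
qed

lemma chain_graph:
  assumes "a \<in> dgraph_chains n m (1 - int n)" "G \<in> Poly_Mapping.keys a" "n \<ge> 1"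
  obtains es where "G = (m, es)" "admissible n (m, es)" "length es = 2 * m + n - 1"
  using assms by (cases G) (force simp: dgraph_chains_def)

text \<open>The \<open>m\<close> factors \<pi> raise the degree by \<open>m\<close>, and the
  \<open>2 * m + n - 1\<close> edges lower it by their number.\<close>

lemma xhom_B_class:
  assumes X: "X \<in> dgraphs n m (1 - int n)" and "n \<ge> 1"
    and fs: "list_all2 (\<lambda>e t. t \<in> xhom e) es fs" "length fs = n"
  shows "B_class d c X fs \<in> xhom (sum_list es - int m - int n + 1)"
  unfolding B_class_def B_chain_def
proof (intro xhom_sum xhom_scale)
  fix G assume "G \<in> Poly_Mapping.keys (SOME a. a \<in> X)"
  from chain_graph[OF some_mem_dgraph_chains[OF X] this \<open>n \<ge> 1\<close>]
  obtain E where G: "G = (m, E)" "admissible n (m, E)" "length E = 2 * m + n - 1" by blast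
  have "list_all2 (\<lambda>e t. t \<in> xhom e) (replicate m 1 @ es) (replicate m (lie_pi d c) @ fs)"
    using fs by (intro list_all2_appendI) (auto simp: list_all2_conv_all_nth xhom_pi)
  then have "B_graph d c G fs \<in> xhom (sum_list (replicate m 1 @ es) - int (length (edge_positions (m, E))))"
    unfolding G(1) B_graph_edge_positions
    using edge_positions_admissible(1)[OF G(2)] fs(2) by (intro xhom_apply_edges) auto
  moreover have "sum_list (replicate m 1 @ es) - int (length (edge_positions (m, E))) =
      sum_list es - int m - int n + 1"
    using G(3) \<open>n \<ge> 1\<close> by (simp add: sum_list_replicate of_nat_diff)
  ultimately show "B_graph d c G fs \<in> xhom (sum_list es - int m - int n + 1)"
    by (simp only:)
qed

lemma B_series_eq_sum:
  assumes X: "X \<in> dgraph_series n (1 - int n)" and "n \<ge> 1"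
    and fs: "list_all2 (\<lambda>e t. t \<in> xhom e) es fs" "length fs = n"
    and N: "sum_list es < int N + int n - 1"
  shows "B_series d c X fs = (\<Sum>m<N. B_class d c (X m) fs)"
proof -
  have "B_class d c (X m) fs = 0" if "m \<ge> N" for m
    by (rule xhom_neg[OF xhom_B_class[OF _ \<open>n \<ge> 1\<close> fs]]) (use X N that in \<open>auto simp: dgraph_series_def\<close>)
  then show ?thesis
    unfolding B_series_def by (intro Sum_any.expand_superset) (auto simp: not_le[symmetric])
qed

lemma B_series_eq_0:
  assumes "X \<in> dgraph_series n (1 - int n)" "n \<ge> 1"
    and "list_all2 (\<lambda>e t. t \<in> xhom e) es fs" "length fs = n" "sum_list es < int n - 1"
  shows "B_series d c X fs = 0"
  using B_series_eq_sum[OF assms(1-4), of 0] assms(5) by simp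

lemma B_series_xhom_0:
  assumes "X \<in> dgraph_series n (1 - int n)" "n \<ge> 1"
    and "list_all2 (\<lambda>e t. t \<in> xhom e) es fs" "length fs = n" "sum_list es = int n - 1"
  shows "B_series d c X fs \<in> xhom 0"
proof -
  have "X 0 \<in> dgraphs n 0 (1 - int n)"
    using assms(1) by (simp add: dgraph_series_def)
  from xhom_B_class[OF this assms(2-4)] show ?thesis
    using B_series_eq_sum[OF assms(1-4), of 1] assms(5) by simp
qed

text \<open>By the degree count only graphs with exactly \<open>m\<close> internal vertices reach
  degree 0, so one class of the infinite series decides the constant term.\<close>

lemma const_part_B_series:
  assumes X: "X \<in> dgraph_series n (1 - int n)" and "n \<ge> 1"
    and fs: "list_all2 (\<lambda>e t. t \<in> xhom e) es fs" "length fs = n"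
    and m: "sum_list es = int m + int n - 1"
  shows "const_part (B_series d c X fs) = const_part (B_class d c (X m) fs)"
proof -
  have "const_part (B_class d c (X m') fs) = 0" if "m' \<noteq> m" for m'
    by (rule const_part_xhom[OF xhom_B_class[OF _ \<open>n \<ge> 1\<close> fs]]) (use X m that in \<open>auto simp: dgraph_series_def\<close>)
  moreover have "B_series d c X fs = (\<Sum>m'<Suc m. B_class d c (X m') fs)"
    by (rule B_series_eq_sum[OF X \<open>n \<ge> 1\<close> fs]) (use m in simp)
  ultimately show ?thesis
    by (simp add: const_part_sum const_part_add)
qed

section \<open>Monomials in two variables\<close>

type_synonym mono = "int \<times> bool \<times> bool \<times> nat \<times> nat"

text \<open>\<open>(r, a, b, i, j)\<close> stands for \<open>r x\<^sub>0\<^sup>i x\<^sub>1\<^sup>j\<close> times \<open>p\<^sup>0\<close> (if \<open>a\<close>) times \<open>p\<^sup>1\<close> (if \<open>b\<close>).\<close>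

definition pset :: "bool \<Rightarrow> bool \<Rightarrow> nat set" where
  "pset a b = (if a then {0} else {}) \<union> (if b then {1} else {})"

definition xmono :: "nat \<Rightarrow> nat \<Rightarrow> nat \<Rightarrow>\<^sub>0 nat" where
  "xmono i j = Poly_Mapping.single 0 i + Poly_Mapping.single 1 j"

fun mono_elem :: "mono \<Rightarrow> 'k::field_char_0 sext" where
  "mono_elem (r, a, b, i, j) = Poly_Mapping.single (pset a b) (Poly_Mapping.single (xmono i j) (of_int r))"

text \<open>At exponent 0 the truncated subtraction is harmless, as the coefficient becomes
  0.\<close>

fun mono_dx :: "nat \<Rightarrow> mono \<Rightarrow> mono" where
  "mono_dx l (r, a, b, i, j) = (if l = 0 then (r * int i, a, b, i - 1, j) else (r * int j, a, b, i, j - 1))"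

text \<open>The sign for \<open>l = 1\<close> arises when \<partial>/\<partial>p^1 passes
  p^0.\<close>

fun mono_dp :: "nat \<Rightarrow> mono \<Rightarrow> mono" where
  "mono_dp l (r, a, b, i, j) =
     (if l = 0 then (if a then r else 0, False, b, i, j)
      else (if b then (if a then - r else r) else 0, a, False, i, j))"

fun mono_inv :: "mono \<Rightarrow> mono" where
  "mono_inv (r, a, b, i, j) = (if a = b then r else - r, a, b, i, j)"

fun mono_const :: "mono \<Rightarrow> int" where
  "mono_const (r, a, b, i, j) = (if \<not> a \<and> \<not> b \<and> i = 0 \<and> j = 0 then r else 0)"

definition mono_tau :: "nat \<Rightarrow> nat \<Rightarrow> nat \<Rightarrow> mono list \<Rightarrow> mono list" where
  "mono_tau l i j ts =
     map (\<lambda>q. let a = (if q = j then mono_dx l (ts ! q) else ts ! q) in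
              if q < i then mono_inv a else if q = i then mono_dp l a else a)
         [0..<length ts]"

text \<open>An executable integer version of the constant term of \<open>apply_edges 2\<close>, so
  that identities over all edge lists can be checked by evaluation.\<close>

fun mono_eval :: "(nat \<times> nat) list \<Rightarrow> mono list \<Rightarrow> int" where
  "mono_eval [] ts = prod_list (map mono_const ts)"
| "mono_eval ((i, j) # es) ts = mono_eval es (mono_tau 0 i j ts) + mono_eval es (mono_tau 1 i j ts)"

lemma lookup_xmono: "Poly_Mapping.lookup (xmono i j) l = (if l = 0 then i else if l = 1 then j else 0)"
  by (auto simp: xmono_def lookup_add lookup_single when_def)

lemma xmono_diff:
  "xmono i j - Poly_Mapping.single 0 1 = xmono (i - 1) j"
  "xmono i j - Poly_Mapping.single 1 1 = xmono i (j - 1)"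
  by (auto intro!: poly_mapping_eqI simp: lookup_minus lookup_xmono lookup_single when_def)

lemma xmono_add: "xmono i j + xmono i' j' = xmono (i + i') (j + j')"
  by (auto intro!: poly_mapping_eqI simp: lookup_add lookup_xmono)

lemma xmono_eq_0_iff: "xmono i j = 0 \<longleftrightarrow> i = 0 \<and> j = 0"
  by (auto simp: poly_mapping_eq_iff fun_eq_iff lookup_xmono)

lemma pset_simps [simp]:
  "pset False False = {}" "pset True False = {0}" "pset False True = {1}" "pset True True = {0, 1}"
  by (auto simp: pset_def)

lemma mono_elem_zero: "mono_elem (0, t) = 0"
  by (cases t) simp

lemma mono_elem_dx:
  assumes "l < 2"
  shows "sext_dx l (mono_elem t) = mono_elem (mono_dx l t)"
proof (cases t)
  case (fields r a b i j)
  have "l = 0 \<or> l = 1" using assms by auto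
  then show ?thesis
    using xmono_diff[of i j]
    by (auto simp: fields sext_dx_def sdiff_single sdiff_0 lookup_xmono when_def mult.commute)
qed

lemma sext_dp_single:
  "sext_dp l (Poly_Mapping.single I f) =
     (if l \<in> I then Poly_Mapping.single (I - {l}) ((- 1) ^ card {i \<in> I. i < l} * f) else 0)"
proof (cases "f = 0")
  case False
  then have "{J \<in> Poly_Mapping.keys (Poly_Mapping.single I f). l \<in> J} = (if l \<in> I then {I} else {})"
    by auto
  then show ?thesis by (simp add: sext_dp_def)
qed (simp add: sext_dp_def)

lemma sext_inv_single:
  "sext_inv (Poly_Mapping.single I f) = Poly_Mapping.single I ((- 1) ^ card I * f)"
  by (simp add: sext_inv_def)

lemma mono_elem_dp:
  assumes "l < 2"
  shows "sext_dp l (mono_elem t) = mono_elem (mono_dp l t)"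
proof (cases t)
  case (fields r a b i j)
  have mem: "0 \<in> pset a b \<longleftrightarrow> a" "1 \<in> pset a b \<longleftrightarrow> b"
    by (auto simp: pset_def)
  have diff: "pset a b - {0} = pset False b" "pset a b - {1} = pset a False"
    by (auto simp: pset_def)
  have "{i \<in> pset a b. i < 0} = {}" "{i \<in> pset a b. i < 1} = pset a False"
    by (auto simp: pset_def)
  then have card: "card {i \<in> pset a b. i < 0} = 0" "card {i \<in> pset a b. i < 1} = (if a then 1 else 0)"
    by (simp_all only: card.empty) (simp add: pset_def)
  have "l = 0 \<or> l = 1"
    using assms by auto
  then show ?thesis
    by (elim disjE) (simp_all only: fields mono_elem.simps sext_dp_single mem diff card, simp_all add: single_uminus)
qed

lemma mono_elem_inv: "sext_inv (mono_elem t) = mono_elem (mono_inv t)"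
  by (cases t rule: mono_inv.cases) (auto simp: sext_inv_single single_uminus pset_def)

lemma mono_elem_const: "const_part (mono_elem t) = of_int (mono_const t)"
  by (cases t rule: mono_const.cases)
    (auto simp: const_part_single pset_def lookup_single when_def xmono_eq_0_iff)

lemma tau_summand_mono_elem:
  assumes "l < 2"
  shows "tau_summand l i j (map mono_elem ts) = map mono_elem (mono_tau l i j ts)"
  using assms unfolding tau_summand_def mono_tau_def
  by (auto simp: Let_def mono_elem_dx mono_elem_dp mono_elem_inv)

lemma const_part_apply_edges_mono_elem:
  "const_part (apply_edges 2 es (map mono_elem ts)) = of_int (mono_eval es ts)"
proof (induction es ts rule: mono_eval.induct)
  case (1 ts)
  then show ?case
    by (induction ts) (simp_all add: const_part_mult const_part_single mono_elem_const)
next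
  case (2 i j es ts)
  then show ?case
    by (simp add: numeral_2_eq_2 const_part_add tau_summand_mono_elem[unfolded numeral_2_eq_2])
qed

section \<open>Products of monomials and the element \<pi>\<close>

lemma sext_mult_times_single:
  "sext_mult (*) (Poly_Mapping.single I f) (Poly_Mapping.single J g) =
     Poly_Mapping.single (I \<union> J) (sconst (wedge_sign I J) * f * g)"
  by (auto simp: sext_mult_def mult.assoc)

fun mono_mult :: "mono \<Rightarrow> mono \<Rightarrow> mono" where
  "mono_mult (r, a, b, i, j) (r', a', b', i', j') =
     (if a \<and> a' \<or> b \<and> b' then 0 else if b \<and> a' then - r * r' else r * r', a \<or> a', b \<or> b', i + i', j + j')"

lemma wedge_sign_pset:
  "wedge_sign (pset a b) (pset a' b') =
     (if a \<and> a' \<or> b \<and> b' then 0 else if b \<and> a' then - 1 else 1)"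
proof -
  have "{(i, j). i \<in> pset a b \<and> j \<in> pset a' b' \<and> j < i} = (if b \<and> a' then {(1, 0)} else {})"
    by (auto simp: pset_def split: if_splits)
  then have card: "card {(i, j). i \<in> pset a b \<and> j \<in> pset a' b' \<and> j < i} = (if b \<and> a' then 1 else 0)"
    by (simp only:) simp
  have inter: "pset a b \<inter> pset a' b' = {} \<longleftrightarrow> \<not> (a \<and> a' \<or> b \<and> b')"
    by (auto simp: pset_def)
  show ?thesis
    unfolding wedge_sign_def card inter by simp
qed

lemma mono_elem_mult: "sext_mult (*) (mono_elem t) (mono_elem t') = mono_elem (mono_mult t t')"
proof (cases t; cases t')
  fix r a b i j r' a' b' i' j'
  assume t: "t = (r, a, b, i, j)" "t' = (r', a', b', i', j')"
  have union: "pset a b \<union> pset a' b' = pset (a \<or> a') (b \<or> b')"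
    by (auto simp: pset_def)
  show ?thesis
    unfolding t mono_elem.simps mono_mult.simps sext_mult_times_single wedge_sign_pset union
    by (simp add: sconst_def mult_single xmono_add)
qed

lemma sext_x_mono_elem: "sext_x 0 = mono_elem (1, False, False, 1, 0)" "sext_x 1 = mono_elem (1, False, False, 0, 1)"
  by (simp_all add: sext_x_def svar_def xmono_def)

lemma sext_p_mono_elem: "sext_p 0 = mono_elem (1, True, False, 0, 0)" "sext_p 1 = mono_elem (1, False, True, 0, 0)"
  by (simp_all add: sext_p_def xmono_def)

lemma sext_scale_mono_elem: "sext_scale (of_int s) (mono_elem (r, t)) = mono_elem (s * r, t)"
proof (cases t)
  case (fields a b i j)
  then show ?thesis
    by (intro poly_mapping_eqI) (auto simp: lookup_sext_scale lookup_sconst_mult lookup_single when_def)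
qed

lemma sext_scale_0 [simp]: "sext_scale 0 a = 0"
  by (intro poly_mapping_eqI) (simp add: lookup_sext_scale sconst_def)

lemma mono_elem_add: "mono_elem (r, t) + mono_elem (r', t) = mono_elem (r + r', t)"
  by (cases t) (simp flip: single_add)

text \<open>The two orders of x_0 and x_1 in the bracket contribute equally, since the signs of the
  structure constants and of the p^i cancel; hence the coefficient 2.\<close>

lemma lie_pi_aff1: "lie_pi 2 aff1 = (mono_elem (2, True, True, 0, 1) :: 'k::field_char_0 sext)"
proof -
  have sum2: "(\<Sum>i<2. f i) = f 0 + f 1" for f :: "nat \<Rightarrow> 'k sext"
    by (simp add: numeral_2_eq_2)
  show ?thesis
    using sext_scale_mono_elem[of 1, where 'a = 'k] sext_scale_mono_elem[of "- 1", where 'a = 'k]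
    by (simp add: lie_pi_def sum2 aff1_def sext_x_mono_elem sext_p_mono_elem mono_elem_mult mono_elem_add
        del: mono_elem.simps One_nat_def)
qed

lemma xhom_mono_elem: "mono_elem (r, a, b, i, j) \<in> xhom (int i + int j)"
  unfolding mono_elem.simps
  by (rule xhom_single) (auto simp: shom_def xmono_def xdeg_add xdeg_single)

section \<open>Enumeration of edge lists and identities valid for every graph\<close>

fun edge_lists :: "nat \<Rightarrow> nat \<Rightarrow> (nat \<times> nat) list list" where
  "edge_lists N 0 = [[]]"
| "edge_lists N (Suc k) =
     [e # es. es \<leftarrow> edge_lists N k, e \<leftarrow> List.product [0..<N] [0..<N], fst e \<noteq> snd e \<and> e \<notin> set es]"

lemma mem_edge_lists:
  "length es = k \<Longrightarrow> distinct es \<Longrightarrow> set es \<subseteq> {(i, j). i < N \<and> j < N \<and> i \<noteq> j} \<Longrightarrow> es \<in> set (edge_lists N k)"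
  by (induction k arbitrary: es) (auto simp: length_Suc_conv)

text \<open>The edge lists include those of inadmissible graphs, which do no harm; the prefix
  \<open>(2, True, True, 0, 1)\<close> is \<open>lie_pi\<close>.\<close>

definition mono_related :: "nat \<Rightarrow> nat \<Rightarrow> int \<Rightarrow> mono list \<Rightarrow> mono list \<Rightarrow> bool" where
  "mono_related n m s ts ts' \<longleftrightarrow>
     list_all (\<lambda>es. mono_eval es (replicate m (2, True, True, 0, 1) @ ts) =
        s * mono_eval es (replicate m (2, True, True, 0, 1) @ ts')) (edge_lists (m + n) (2 * m + n - 1))"

lemma const_part_B_graph_mono:
  "const_part (B_graph 2 aff1 (m, E) (map mono_elem us)) =
     of_int (mono_eval (edge_positions (m, E)) (replicate m (2, True, True, 0, 1) @ us))"
proof -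
  have *: "map mono_elem (replicate m (2, True, True, 0, 1) @ us) =
      replicate m (mono_elem (2, True, True, 0, 1)) @ map mono_elem us"
    by (simp only: map_append map_replicate)
  show ?thesis
    by (subst B_graph_edge_positions, subst lie_pi_aff1, subst *[symmetric])
      (rule const_part_apply_edges_mono_elem)
qed

lemma const_part_B_class:
  "const_part (B_class d c X fs) = (\<Sum>G\<in>Poly_Mapping.keys (SOME a. a \<in> X).
     Poly_Mapping.lookup (SOME a. a \<in> X) G * const_part (B_graph d c G fs))"
  by (simp only: B_class_def B_chain_def const_part_sum const_part_scale)

lemma const_part_B_graph_related:
  assumes a: "a \<in> dgraph_chains n m (1 - int n)" "G \<in> Poly_Mapping.keys a" "n \<ge> 1"
    and rel: "mono_related n m s ts ts'"
  shows "const_part (B_graph 2 aff1 G (map mono_elem ts)) =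
      of_int s * const_part (B_graph 2 aff1 G (map mono_elem ts'))"
proof -
  obtain E where G: "G = (m, E)" "admissible n (m, E)" "length E = 2 * m + n - 1"
    by (rule chain_graph[OF a])
  let ?E = "edge_positions (m, E)"
  have "length ?E = 2 * m + n - 1"
    using G(3) by simp
  from mem_edge_lists[OF this edge_positions_admissible(2,1)[OF G(2)]]
  have "mono_eval ?E (replicate m (2, True, True, 0, 1) @ ts) =
      s * mono_eval ?E (replicate m (2, True, True, 0, 1) @ ts')"
    by (rule bspec[OF rel[unfolded mono_related_def list_all_iff]])
  then show ?thesis
    by (simp only: G(1) const_part_B_graph_mono of_int_mult)
qed

text \<open>The relation holds graph by graph with the same factor \<open>s\<close>, hence for every
  linear combination, whatever its unknown coefficients.\<close>

lemma const_part_B_class_related: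
  assumes X: "X \<in> dgraphs n m (1 - int n)" and "n \<ge> 1" and rel: "mono_related n m s ts ts'"
  shows "const_part (B_class 2 aff1 X (map mono_elem ts)) =
      of_int s * const_part (B_class 2 aff1 X (map mono_elem ts'))"
  unfolding const_part_B_class sum_distrib_left
proof (rule sum.cong[OF refl], goal_cases)
  case (1 G)
  show ?case
    unfolding const_part_B_graph_related[OF some_mem_dgraph_chains[OF X] 1 \<open>n \<ge> 1\<close> rel]
    by (rule mult.left_commute)
qed

definition mono_xdeg :: "mono \<Rightarrow> nat" where
  "mono_xdeg = (\<lambda>(r, a, b, i, j). i + j)"

lemma xhom_map_mono_elem:
  "list_all2 (\<lambda>e t. t \<in> xhom e) (map (int \<circ> mono_xdeg) ts) (map mono_elem ts)"
  by (auto simp: list_all2_conv_all_nth mono_xdeg_def split: prod.split intro: xhom_mono_elem simp del: mono_elem.simps)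

lemma sum_list_map_int: "sum_list (map (int \<circ> f) xs) = int (sum_list (map f xs))"
  by (induction xs) simp_all

lemma const_part_B_series_mono:
  fixes X :: "nat \<Rightarrow> (dgraph \<Rightarrow>\<^sub>0 'k::field_char_0) set"
  assumes X: "X \<in> dgraph_series n (1 - int n)" and n: "n \<ge> 1"
    and ts: "length ts = n" "sum_list (map mono_xdeg ts) = m + n - 1"
  shows "const_part (B_series 2 aff1 X (map mono_elem ts)) =
    const_part (B_class 2 aff1 (X m) (map mono_elem ts))"
proof -
  have len: "length (map mono_elem ts :: 'k sext list) = n"
    using ts(1) by simp
  have "int (m + n - 1) = int m + int n - 1"
    using n by linarith
  then have "sum_list (map (int \<circ> mono_xdeg) ts) = int m + int n - 1"
    unfolding sum_list_map_int ts(2) .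
  from const_part_B_series[OF X n xhom_map_mono_elem len this] show ?thesis .
qed

lemma const_part_B_series_related:
  fixes X :: "nat \<Rightarrow> (dgraph \<Rightarrow>\<^sub>0 'k::field_char_0) set"
  assumes X: "X \<in> dgraph_series n (1 - int n)" and n: "n \<ge> 1"
    and ts: "length ts = n" "sum_list (map mono_xdeg ts) = m + n - 1"
    and ts': "length ts' = n" "sum_list (map mono_xdeg ts') = m + n - 1"
    and rel: "mono_related n m s ts ts'"
  shows "const_part (B_series 2 aff1 X (map mono_elem ts)) =
      of_int s * const_part (B_series 2 aff1 X (map mono_elem ts'))"
proof -
  have "X m \<in> dgraphs n m (1 - int n)"
    using X by (simp add: dgraph_series_def)
  from const_part_B_class_related[OF this n rel] show ?thesis
    by (simp only: const_part_B_series_mono[OF X n ts] const_part_B_series_mono[OF X n ts'])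
qed

abbreviation "mono_x0 \<equiv> (1, False, False, Suc 0, 0) :: mono"
abbreviation "mono_x1 \<equiv> (1, False, False, 0, Suc 0) :: mono"
abbreviation "mono_p0 \<equiv> (1, True, False, 0, 0) :: mono"
abbreviation "mono_p1 \<equiv> (1, False, True, 0, 0) :: mono"

text \<open>At most 120 edge lists are evaluated per identity. An edge pairs p^l at its source with
  x_l at its target, and the two ends differ. The factor 0 occurs when a match would need a loop or
  an argument is 0; the second list then only supplies the right length and degree. The other
  identities rename matched indices, pull out a sign, or, for the penultimate one, use the
  antisymmetry of \<pi>.\<close>

lemma mono_related_facts:
  "mono_related 2 0 1 [mono_p1, mono_x1] [mono_p0, mono_x0]"
  "mono_related 3 0 0 [(1, True, False, Suc 0, 0), mono_p1, mono_x1] [mono_x0, mono_x0, mono_p0]"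
  "mono_related 3 0 0 [mono_x0, mono_p0, (1, False, True, 0, Suc 0)] [mono_x0, mono_x0, mono_p0]"
  "mono_related 3 0 0 [mono_x0, (0, True, False, 0, 0), mono_x0] [mono_x0, mono_x0, mono_p0]"
  "mono_related 3 0 (- 1) [(- 1, False, True, 0, Suc 0), mono_p1, mono_x1]
     [(1, True, False, Suc 0, 0), mono_p0, mono_x0]"
  "mono_related 3 0 1 [mono_x0, mono_p1, (1, True, False, 0, Suc 0)]
     [mono_x0, mono_p0, (1, True, False, Suc 0, 0)]"
  "mono_related 3 0 (- 1) [mono_x0, (- 1, True, True, 0, 0), mono_x1]
     [mono_x0, (1, True, True, 0, 0), mono_x1]"
  "mono_related 2 1 1 [(1, False, True, Suc 0, 0), mono_x1] [(- 1, False, True, 0, Suc 0), mono_x0]"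
  "mono_related 2 1 (- 1) [mono_x0, (- 1, False, True, 0, Suc 0)] [mono_x0, (1, False, True, 0, Suc 0)]"
  by code_simp+

section \<open>The equations of an \<open>A\<^sub>\<infinity>\<close>-morphism of strict algebras\<close>

lemma sum_split_triples:
  "(\<Sum>(r, s, t)\<in>{(r, s, t). r + s + t = n \<and> 1 \<le> s}. g r s t) =
     (\<Sum>s\<in>{1..n}. \<Sum>r\<le>n - s. g r s (n - s - r))" for g :: "nat \<Rightarrow> nat \<Rightarrow> nat \<Rightarrow> 'a::comm_monoid_add"
proof -
  have "(\<Sum>(r, s, t)\<in>{(r, s, t). r + s + t = n \<and> 1 \<le> s}. g r s t) =
      (\<Sum>(s, r)\<in>(SIGMA s:{1..n}. {..n - s}). g r s (n - s - r))"
    by (rule sum.reindex_bij_witness[of _ "\<lambda>(s, r). (r, s, n - s - r)" "\<lambda>(r, s, t). (s, r)"]) auto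
  then show ?thesis
    by (simp add: sum.Sigma)
qed

lemma length_le_sum_list: "0 \<notin> set js \<Longrightarrow> length js \<le> sum_list (js :: nat list)"
  by (induction js) auto

lemma finite_compositions: "finite (compositions n)"
proof (rule finite_subset)
  show "compositions n \<subseteq> {js. set js \<subseteq> {..n} \<and> length js \<le> n}"
    using length_le_sum_list member_le_sum_list by (fastforce simp: compositions_def)
qed (rule finite_lists_length_le, simp)

lemma sext_scale_zero: "sext_scale r 0 = 0"
  by (intro poly_mapping_eqI) (simp add: lookup_sext_scale)

lemma sext_scale_one: "sext_scale 1 a = a"
  by (intro poly_mapping_eqI) (simp add: lookup_sext_scale lookup_sconst_mult)

text \<open>A strict target leaves only the compositions \<open>[n]\<close> and
  \<open>[i, n - i]\<close>; for the latter \<sigma> is \<open>i - 1\<close>.\<close>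

lemma ainf_rhs_strict:
  assumes n: "length as = n" "n \<ge> 2"
  shows "ainf_rhs sext_scale (strict_ainf D mul) f ks as = D (f n as) +
    (\<Sum>i\<in>{1..<n}. sext_scale ((- 1) ^ (i - 1) * (- 1) powi ((1 - int (n - i)) * sum_list (take i ks)))
       (mul (f i (take i as)) (f (n - i) (drop i as))))"
proof -
  define T where "T js = (let r = length js in
        sext_scale ((-1) ^ (\<Sum>q<r. (r - 1 - q) * (js ! q - 1)) *
            (-1) powi (\<Sum>q<r. (1 - int (js ! q)) * sum_list (take (sum_list (take q js)) ks)))
           (strict_ainf D mul r (map (\<lambda>q. f (js ! q) (block js q as)) [0..<r])))" for js
  let ?S = "insert [n] ((\<lambda>i. [i, n - i]) ` {1..<n})"
  have "ainf_rhs sext_scale (strict_ainf D mul) f ks as = sum T (compositions n)"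
    by (simp add: ainf_rhs_def T_def n)
  also have "\<dots> = sum T ?S"
  proof (rule sum.mono_neutral_right)
    show "?S \<subseteq> compositions n"
      using n by (auto simp: compositions_def)
    show "\<forall>js\<in>compositions n - ?S. T js = 0"
    proof
      fix js assume js: "js \<in> compositions n - ?S"
      have "length js \<noteq> 1"
        using js by (auto simp: compositions_def length_Suc_conv)
      moreover have "length js \<noteq> 2"
      proof
        assume "length js = 2"
        then obtain i j where "js = [i, j]"
          by (auto simp: numeral_2_eq_2 length_Suc_conv)
        then have "js = [i, n - i]" "i \<in> {1..<n}"
          using js by (auto simp: compositions_def)
        then show False using js by blast
      qed
      ultimately show "T js = 0"
        by (simp add: T_def Let_def strict_ainf_def sext_scale_zero)
    qed
  qed (rule finite_compositions)
  also have "\<dots> = T [n] + (\<Sum>i\<in>{1..<n}. T [i, n - i])"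
    by (subst sum.insert) (auto simp: sum.reindex inj_on_def)
  also have "T [n] = D (f n as)"
    using n by (simp add: T_def strict_ainf_def block_def sext_scale_one)
  also have "(\<Sum>i\<in>{1..<n}. T [i, n - i]) =
    (\<Sum>i\<in>{1..<n}. sext_scale ((- 1) ^ (i - 1) * (- 1) powi ((1 - int (n - i)) * sum_list (take i ks)))
       (mul (f i (take i as)) (f (n - i) (drop i as))))"
    using n by (intro sum.cong refl)
      (simp add: T_def Let_def strict_ainf_def block_def upt_conv_Cons numeral_2_eq_2)
  finally show ?thesis .
qed

lemma const_part_ainf_lhs_2:
  "const_part (ainf_lhs sext_scale (strict_ainf D mul) f [0, 0] [a, b]) =
     const_part (f 1 [mul a b]) - const_part (f 2 [D a, b]) - const_part (f 2 [a, D b])"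
  unfolding ainf_lhs_def sum_split_triples const_part_sum const_part_scale
  by (simp add: eval_nat_numeral strict_ainf_def)

lemma const_part_ainf_lhs_3:
  "const_part (ainf_lhs sext_scale (strict_ainf D mul) f [0, 1, 0] [a, b, c]) =
     const_part (f 3 [D a, b, c]) + const_part (f 3 [a, D b, c]) - const_part (f 3 [a, b, D c]) +
     const_part (f 2 [mul a b, c]) - const_part (f 2 [a, mul b c]) + const_part (f 1 [0])"
  unfolding ainf_lhs_def sum_split_triples const_part_sum const_part_scale
  by (simp add: eval_nat_numeral strict_ainf_def)

text \<open>The values at 0 come from the vanishing operations m_3 and m_4. They remain here because
  \<open>f\<close> is arbitrary, and disappear once \<open>f\<close> is given by graphs.\<close>

lemma const_part_ainf_lhs_4:
  "const_part (ainf_lhs sext_scale (strict_ainf D mul) f [0, 1, 1, 0] [a, b, c, e]) =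
     - const_part (f 4 [D a, b, c, e]) - const_part (f 4 [a, D b, c, e]) +
     const_part (f 4 [a, b, D c, e]) - const_part (f 4 [a, b, c, D e]) +
     const_part (f 3 [mul a b, c, e]) - const_part (f 3 [a, mul b c, e]) + const_part (f 3 [a, b, mul c e]) -
     const_part (f 2 [0, e]) - const_part (f 2 [a, 0]) + const_part (f 1 [0])"
  unfolding ainf_lhs_def sum_split_triples const_part_sum const_part_scale
  by (simp add: eval_nat_numeral strict_ainf_def)

lemma const_part_ainf_rhs_2:
  "const_part (ainf_rhs sext_scale (strict_ainf D mul) f [0, 0] [a, b]) =
     const_part (D (f 2 [a, b])) + const_part (mul (f 1 [a]) (f 1 [b]))"
  by (simp add: ainf_rhs_strict[OF refl] const_part_add const_part_sum const_part_scale eval_nat_numeral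
      atLeastLessThanSuc)

lemma const_part_ainf_rhs_3:
  "const_part (ainf_rhs sext_scale (strict_ainf D mul) f [0, 1, 0] [a, b, c]) =
     const_part (D (f 3 [a, b, c])) + const_part (mul (f 1 [a]) (f 2 [b, c])) -
     const_part (mul (f 2 [a, b]) (f 1 [c]))"
  by (simp add: ainf_rhs_strict[OF refl] const_part_add const_part_sum const_part_scale eval_nat_numeral
      atLeastLessThanSuc)

lemma const_part_ainf_rhs_4:
  "const_part (ainf_rhs sext_scale (strict_ainf D mul) f [0, 1, 1, 0] [a, b, c, e]) =
     const_part (D (f 4 [a, b, c, e])) + const_part (mul (f 1 [a]) (f 3 [b, c, e])) +
     const_part (mul (f 2 [a, b]) (f 2 [c, e])) + const_part (mul (f 3 [a, b, c]) (f 1 [e]))"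
  by (simp add: ainf_rhs_strict[OF refl] const_part_add const_part_sum const_part_scale eval_nat_numeral
      atLeastLessThanSuc)

section \<open>The differential on monomials\<close>

text \<open>Every term of the differential carries some p^i, so the term with \<open>D\<close> drops
  out of the right-hand side of each equation.\<close>

lemma const_part_ce_diff: "const_part (ce_diff d c a) = 0"
  by (simp add: ce_diff_def const_part_diff const_part_sum const_part_scale const_part_mult
      sext_p_def const_part_single)

lemma sad_aff1:
  "sad 2 aff1 0 f = svar 1 * sdiff 1 f" "sad 2 aff1 1 f = - (svar 1 * sdiff 0 f)"
  by (simp_all add: sad_def aff1_def sconst_def eval_nat_numeral single_uminus)

lemma map_sad_single:
  "Poly_Mapping.map (sad d c l) (Poly_Mapping.single I f) = Poly_Mapping.single I (sad d c l f)"
  by (intro poly_mapping_eqI) (simp add: Poly_Mapping.map.rep_eq lookup_single when_def sad_def sdiff_0)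

lemma map_sad_mono_elem:
  "Poly_Mapping.map (sad 2 aff1 0) (mono_elem (r, a, b, i, j)) = mono_elem (r * int j, a, b, i, j)"
  "Poly_Mapping.map (sad 2 aff1 1) (mono_elem (r, a, b, i, j)) = mono_elem (- r * int i, a, b, i - 1, j + 1)"
proof -
  have svar: "svar 1 = Poly_Mapping.single (xmono 0 1) 1"
    by (simp add: svar_def xmono_def)
  show "Poly_Mapping.map (sad 2 aff1 0) (mono_elem (r, a, b, i, j)) = mono_elem (r * int j, a, b, i, j)"
    unfolding mono_elem.simps map_sad_single sad_aff1 svar sdiff_single xmono_diff lookup_xmono mult_single
      xmono_add
    by (cases j) (simp_all add: mult.commute)
  show "Poly_Mapping.map (sad 2 aff1 1) (mono_elem (r, a, b, i, j)) = mono_elem (- r * int i, a, b, i - 1, j + 1)"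
    unfolding mono_elem.simps map_sad_single sad_aff1 svar sdiff_single xmono_diff lookup_xmono mult_single
      xmono_add
    by (simp add: mult.commute single_uminus)
qed

text \<open>All brackets are multiples of x_1, so only \<partial>/\<partial>p^1 survives in the
  second term; its two equal contributions absorb the factor 1/2.\<close>

lemma ce_diff_aff1:
  fixes t :: mono
  shows "ce_diff 2 aff1 (mono_elem t :: 'k::field_char_0 sext) =
     sext_mult (*) (sext_p 0) (Poly_Mapping.map (sad 2 aff1 0) (mono_elem t)) +
     sext_mult (*) (sext_p 1) (Poly_Mapping.map (sad 2 aff1 1) (mono_elem t)) -
     mono_elem (mono_mult (1, True, True, 0, 0) (mono_dp 1 t))"
proof -
  have sum2: "(\<Sum>i<2. f i) = f 0 + f 1" for f :: "nat \<Rightarrow> 'k sext"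
    by (simp add: numeral_2_eq_2)
  have p01: "sext_mult (*) (sext_p 0) (sext_p 1) = (mono_elem (1, True, True, 0, 0) :: 'k sext)"
    "sext_mult (*) (sext_p 1) (sext_p 0) = (mono_elem (- 1, True, True, 0, 0) :: 'k sext)"
    by (simp_all only: sext_p_mono_elem mono_elem_mult) simp_all
  have dp: "sext_dp 1 (mono_elem t) = (mono_elem (mono_dp 1 t) :: 'k sext)"
    by (rule mono_elem_dp) simp
  obtain r u where u: "mono_dp 1 t = (r, u)" by (cases "mono_dp 1 t")
  obtain r' u' where u': "mono_mult (1, True, True, 0, 0) (r, u) = (r', u')"
    by (cases "mono_mult (1, True, True, 0, 0) (r, u)")
  have "mono_mult (- 1, True, True, 0, 0) (r, u) = (- r', u')"
    using u' by (cases u) (auto split: if_splits)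
  then have "(\<Sum>i<2. \<Sum>j<2. \<Sum>k<2. sext_scale (aff1 i j k)
      (sext_mult (*) (sext_mult (*) (sext_p i) (sext_p j)) (sext_dp k (mono_elem t)))) =
      (mono_elem (r' + r', u') :: 'k sext)"
    using sext_scale_mono_elem[of 1 r' u', where 'a = 'k] sext_scale_mono_elem[of "- 1" "- r'" u', where 'a = 'k]
    by (simp add: sum2 aff1_def p01 dp u mono_elem_mult u' mono_elem_add del: One_nat_def mono_elem.simps)
  moreover have "sext_scale (1 / 2) (mono_elem (r' + r', u')) = (mono_elem (r', u') :: 'k sext)"
    by (cases u') (auto intro!: poly_mapping_eqI simp: lookup_sext_scale lookup_sconst_mult lookup_single when_def)
  ultimately show ?thesis
    by (simp add: ce_diff_def sum2 u u' del: One_nat_def mono_elem.simps)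
qed

text \<open>Zero is written as a monomial with coefficient 0, so that facts about lists of monomials
  apply to it.\<close>

lemma ce_diff_mono:
  "ce_diff 2 aff1 (mono_elem mono_x0) = mono_elem (- 1, False, True, 0, Suc 0)"
  "ce_diff 2 aff1 (mono_elem mono_x1) = mono_elem (1, True, False, 0, Suc 0)"
  "ce_diff 2 aff1 (mono_elem mono_p0) = mono_elem (0, False, False, 0, 0)"
  "ce_diff 2 aff1 (mono_elem mono_p1) = mono_elem (- 1, True, True, 0, 0)"
  unfolding ce_diff_aff1 map_sad_mono_elem sext_p_mono_elem mono_elem_mult
  by (simp_all add: mono_elem_zero single_uminus)

lemma mono_elem_grade:
  "mono_elem (r, a, b, i, j) \<in> sext_grade 2 (of_bool a + of_bool b)"
  by (auto simp: sext_grade_def pset_def sym_alg_def xmono_def split: if_splits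
      dest!: Poly_Mapping.keys_add[THEN subsetD])

lemma xdeg_eq_0_iff: "xdeg u = 0 \<longleftrightarrow> u = 0"
  by (auto simp: xdeg_def in_keys_iff intro!: poly_mapping_eqI)

lemma sext_grade_0_xhom_0:
  assumes "a \<in> sext_grade d 0" "a \<in> xhom 0"
  shows "a = Poly_Mapping.single {} (sconst (const_part a))"
proof (rule poly_mapping_eqI)
  fix I
  show "Poly_Mapping.lookup a I = Poly_Mapping.lookup (Poly_Mapping.single {} (sconst (const_part a))) I"
  proof (cases "I = {}")
    case True
    have "Poly_Mapping.lookup (Poly_Mapping.lookup a {}) u = 0" if "u \<noteq> 0" for u
      using assms(2) that xdeg_eq_0_iff[of u] by (force simp: xhom_def shom_def in_keys_iff)
    then show ?thesis
      unfolding True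
      by (intro poly_mapping_eqI) (auto simp: const_part_def sconst_def lookup_single when_def)
  next
    case False
    have "I \<notin> Poly_Mapping.keys a"
      using assms(1) False finite_subset[of I "{..<d}"] by (auto simp: sext_grade_def)
    with False show ?thesis
      by (simp add: in_keys_iff lookup_single)
  qed
qed

section \<open>The contradiction\<close>

locale universal_duflo_morphism =
  fixes \<Gamma> :: "nat \<Rightarrow> nat \<Rightarrow> (dgraph \<Rightarrow>\<^sub>0 'k::field_char_0) set"
  assumes series: "\<And>n. n \<ge> 2 \<Longrightarrow> \<Gamma> n \<in> dgraph_series n (1 - int n)"
    and morphism: "ainf_morphism
      sext_scale (sext_grade 2) (strict_ainf (ce_diff 2 aff1) (sext_mult (*)))
      sext_scale (sext_grade 2) (strict_ainf (ce_diff 2 aff1) (sext_mult (duflo_mult 2 aff1)))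
      (\<lambda>n. if n = 1 then hd else B_series 2 aff1 (\<Gamma> n))"
begin

abbreviation f :: "nat \<Rightarrow> 'k sext list \<Rightarrow> 'k sext" where
  "f n \<equiv> if n = 1 then hd else B_series 2 aff1 (\<Gamma> n)"

text \<open>These constant terms are the unknowns of the final contradiction.\<close>

definition F :: "nat \<Rightarrow> mono list \<Rightarrow> 'k" where
  "F n ts = const_part (B_series 2 aff1 (\<Gamma> n) (map mono_elem ts))"

lemma const_part_B_series_list:
  "const_part (B_series 2 aff1 (\<Gamma> n) [mono_elem a, mono_elem b]) = F n [a, b]"
  "const_part (B_series 2 aff1 (\<Gamma> n) [mono_elem a, mono_elem b, mono_elem c]) = F n [a, b, c]"
  "const_part (B_series 2 aff1 (\<Gamma> n) [mono_elem a, mono_elem b, mono_elem c, mono_elem e]) = F n [a, b, c, e]"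
  by (simp_all add: F_def del: mono_elem.simps)

lemma F_related:
  assumes "mono_related n m s ts ts'" "n \<ge> 2"
    and "length ts = n" "sum_list (map mono_xdeg ts) = m + n - 1"
    and "length ts' = n" "sum_list (map mono_xdeg ts') = m + n - 1"
  shows "F n ts = of_int s * F n ts'"
  unfolding F_def using assms series[of n] by (intro const_part_B_series_related) auto

lemma B_series_small:
  assumes "n \<ge> 2" "length ts = n" "sum_list (map mono_xdeg ts) < n - 1"
  shows "B_series 2 aff1 (\<Gamma> n) (map mono_elem ts) = 0"
proof (rule B_series_eq_0[OF series[OF \<open>n \<ge> 2\<close>] _ xhom_map_mono_elem])
  show "sum_list (map (int \<circ> mono_xdeg) ts) < int n - 1"
    unfolding sum_list_map_int using assms by linarith
qed (use assms in auto)

lemma F_small: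
  "n \<ge> 2 \<Longrightarrow> length ts = n \<Longrightarrow> sum_list (map mono_xdeg ts) < n - 1 \<Longrightarrow> F n ts = 0"
  unfolding F_def by (subst B_series_small) auto

lemma F_relations:
  "F 2 [mono_p1, mono_x1] = F 2 [mono_p0, mono_x0]"
  "F 3 [(1, True, False, Suc 0, 0), mono_p1, mono_x1] = 0"
  "F 3 [mono_x0, mono_p0, (1, False, True, 0, Suc 0)] = 0"
  "F 3 [mono_x0, (0, True, False, 0, 0), mono_x0] = 0"
  "F 3 [(- 1, False, True, 0, Suc 0), mono_p1, mono_x1] =
     - F 3 [(1, True, False, Suc 0, 0), mono_p0, mono_x0]"
  "F 3 [mono_x0, mono_p1, (1, True, False, 0, Suc 0)] =
     F 3 [mono_x0, mono_p0, (1, True, False, Suc 0, 0)]"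
  "F 3 [mono_x0, (- 1, True, True, 0, 0), mono_x1] = - F 3 [mono_x0, (1, True, True, 0, 0), mono_x1]"
  "F 2 [(1, False, True, Suc 0, 0), mono_x1] = F 2 [(- 1, False, True, 0, Suc 0), mono_x0]"
  "F 2 [mono_x0, (- 1, False, True, 0, Suc 0)] = - F 2 [mono_x0, (1, False, True, 0, Suc 0)]"
  using mono_related_facts[THEN F_related] by (simp_all add: mono_xdeg_def)

lemma morphism_eq:
  assumes "n \<ge> 1" "length as = n" "homogeneous_list (sext_grade 2) ks as"
  shows "ainf_lhs sext_scale (strict_ainf (ce_diff 2 aff1) (sext_mult (*))) f ks as =
    ainf_rhs sext_scale (strict_ainf (ce_diff 2 aff1) (sext_mult (duflo_mult 2 aff1))) f ks as"
  using morphism assms unfolding ainf_morphism_def by blast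

lemma f_grade:
  assumes "n \<ge> 1" "length as = n" "homogeneous_list (sext_grade 2) ks as"
  shows "f n as \<in> sext_grade 2 (sum_list ks + (1 - int n))"
  using morphism assms unfolding ainf_morphism_def graded_multilinear_def by blast

lemma mono_grades:
  "mono_elem mono_x0 \<in> (sext_grade 2 0 :: 'k sext set)"
  "mono_elem mono_x1 \<in> (sext_grade 2 0 :: 'k sext set)"
  "mono_elem mono_p0 \<in> (sext_grade 2 1 :: 'k sext set)"
  "mono_elem mono_p1 \<in> (sext_grade 2 1 :: 'k sext set)"
  using mono_elem_grade[of 1 False False "Suc 0" 0, where 'a = 'k]
    mono_elem_grade[of 1 False False 0 "Suc 0", where 'a = 'k]
    mono_elem_grade[of 1 True False 0 0, where 'a = 'k]
    mono_elem_grade[of 1 False True 0 0, where 'a = 'k]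
  by (simp_all del: mono_elem.simps)

text \<open>The degree count gives degree 0 in the x_i, and the grading of the morphism gives
  exterior degree 0. The full value is wanted, because the Duflo product is known for explicit
  factors only.\<close>

lemma B_series_scalar:
  assumes "homogeneous_list (sext_grade 2) ks (map mono_elem ts :: 'k sext list)" "sum_list ks = int n - 1" "n \<ge> 2"
    and "length ts = n" "sum_list (map mono_xdeg ts) = n - 1"
  shows "B_series 2 aff1 (\<Gamma> n) (map mono_elem ts) = Poly_Mapping.single {} (sconst (F n ts))"
proof -
  have "B_series 2 aff1 (\<Gamma> n) (map mono_elem ts) \<in> sext_grade 2 0"
    using f_grade[of n "map mono_elem ts" ks] assms by simp
  moreover have "sum_list (map (int \<circ> mono_xdeg) ts) = int n - 1"
    unfolding sum_list_map_int using assms by linarith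
  then have "B_series 2 aff1 (\<Gamma> n) (map mono_elem ts) \<in> xhom 0"
    using assms by (intro B_series_xhom_0[OF series _ xhom_map_mono_elem]) auto
  ultimately show ?thesis
    unfolding F_def by (rule sext_grade_0_xhom_0)
qed

lemma f2_scalars:
  "B_series 2 aff1 (\<Gamma> 2) [mono_elem mono_x0, mono_elem mono_p0] =
     Poly_Mapping.single {} (sconst (F 2 [mono_x0, mono_p0]))"
  "B_series 2 aff1 (\<Gamma> 2) [mono_elem mono_x0, mono_elem mono_p1] =
     Poly_Mapping.single {} (sconst (F 2 [mono_x0, mono_p1]))"
  "B_series 2 aff1 (\<Gamma> 2) [mono_elem mono_p0, mono_elem mono_x0] =
     Poly_Mapping.single {} (sconst (F 2 [mono_p0, mono_x0]))"
  "B_series 2 aff1 (\<Gamma> 2) [mono_elem mono_p1, mono_elem mono_x1] =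
     Poly_Mapping.single {} (sconst (F 2 [mono_p1, mono_x1]))"
  using B_series_scalar[of "[0, 1]" "[mono_x0, mono_p0]" 2] B_series_scalar[of "[0, 1]" "[mono_x0, mono_p1]" 2]
    B_series_scalar[of "[1, 0]" "[mono_p0, mono_x0]" 2] B_series_scalar[of "[1, 0]" "[mono_p1, mono_x1]" 2]
    mono_grades
  by (simp_all add: homogeneous_list_def mono_xdeg_def del: mono_elem.simps)

lemma sconst_eq_0_iff: "sconst r = 0 \<longleftrightarrow> r = 0"
  using lookup_sconst[of r] by (metis lookup_zero sconst_def single_zero)

lemma svar_neq_0: "svar i \<noteq> 0"
proof
  assume "svar i = (0 :: 'a spoly)"
  then have "Poly_Mapping.lookup (svar i :: 'a spoly) (Poly_Mapping.single i 1) = 0"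
    by simp
  then show False
    by (simp add: svar_def)
qed

lemma const_part_duflo_scalars:
  "const_part (sext_mult (duflo_mult 2 aff1) (Poly_Mapping.single {} (sconst r))
     (Poly_Mapping.single {} (sconst s))) = (r * s :: 'k)"
  using duflo_mult_aff1_sconst[of r s] by (auto simp: const_part_mult_gen sconst_eq_0_iff)

lemma mono_x_sext: "mono_elem mono_x0 = Poly_Mapping.single {} (svar 0)"
  "mono_elem mono_x1 = Poly_Mapping.single {} (svar 1)"
  by (simp_all add: svar_def xmono_def)

lemma const_part_duflo_scalar_x:
  "const_part (sext_mult (duflo_mult 2 aff1) (mono_elem mono_x0) (Poly_Mapping.single {} (sconst r))) = (0 :: 'k)"
  "const_part (sext_mult (duflo_mult 2 aff1) (Poly_Mapping.single {} (sconst r)) (mono_elem mono_x1)) = (0 :: 'k)"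
  unfolding mono_x_sext using duflo_mult_aff1_sconst_svar(2)[of 0 r] duflo_mult_aff1_sconst_svar(1)[of 1 r]
  by (simp_all add: const_part_mult_gen)

lemma const_part_duflo_x0_x0:
  "const_part (sext_mult (duflo_mult 2 aff1) (mono_elem mono_x0) (mono_elem mono_x0)) = (- 1 / 24 :: 'k)"
  unfolding mono_x_sext using duflo_mult_aff1_svar_svar[where 'k = 'k]
  by (simp add: const_part_mult_gen svar_neq_0)

lemma const_part_mult_0:
  "const_part (sext_mult mS a 0) = 0" "const_part (sext_mult mS 0 a) = 0"
  by (simp_all add: const_part_mult_gen)

section \<open>The four equations between constant terms\<close>

lemma equation_x0_x0:
  "F 2 [(- 1, False, True, 0, Suc 0), mono_x0] + F 2 [mono_x0, (- 1, False, True, 0, Suc 0)] = 1 / 24"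
proof -
  have "homogeneous_list (sext_grade 2) [0, 0] [mono_elem mono_x0, mono_elem mono_x0 :: 'k sext]"
    using mono_grades by (simp add: homogeneous_list_def del: mono_elem.simps)
  \<comment> \<open>Neither x_0^2 nor the differential has a constant term, so the two values of f_2
    must balance the -1/24 of the Duflo product.\<close>
  from arg_cong[OF morphism_eq[OF _ _ this, of 2], of const_part]
  show ?thesis
    unfolding const_part_ainf_lhs_2 const_part_ainf_rhs_2 const_part_ce_diff ce_diff_mono mono_elem_mult
    by (simp add: const_part_duflo_x0_x0 const_part_B_series_list mono_elem_const algebra_simps del: mono_elem.simps)
qed

text \<open>On the right-hand side f_2 takes scalar values, and a scalar times x_0 or x_1 has no
  constant term under the Duflo product.\<close>

lemma equation_x0_p1_x1:
  "F 3 [(- 1, False, True, 0, Suc 0), mono_p1, mono_x1] + F 3 [mono_x0, (- 1, True, True, 0, 0), mono_x1] -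
     F 3 [mono_x0, mono_p1, (1, True, False, 0, Suc 0)] + F 2 [(1, False, True, Suc 0, 0), mono_x1] -
     F 2 [mono_x0, (1, False, True, 0, Suc 0)] = 0"
proof -
  have "homogeneous_list (sext_grade 2) [0, 1, 0]
      [mono_elem mono_x0, mono_elem mono_p1, mono_elem mono_x1 :: 'k sext]"
    using mono_grades by (simp add: homogeneous_list_def del: mono_elem.simps)
  from arg_cong[OF morphism_eq[OF _ _ this, of 3], of const_part]
  show ?thesis
    unfolding const_part_ainf_lhs_3 const_part_ainf_rhs_3 const_part_ce_diff ce_diff_mono mono_elem_mult
    by (simp add: f2_scalars const_part_duflo_scalar_x const_part_B_series_list del: mono_elem.simps)
qed

text \<open>Zero is homogeneous of every degree; giving it the opposite of the other degree makes
  the total 0, below the bound 1 for n = 2.\<close>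

lemma f_zero_arg:
  "B_series 2 aff1 (\<Gamma> 2) [0, mono_elem t] = 0" "B_series 2 aff1 (\<Gamma> 2) [mono_elem t, 0] = 0"
proof -
  have t: "mono_elem t \<in> xhom (int (mono_xdeg t))"
    using xhom_map_mono_elem[of "[t]"] by simp
  show "B_series 2 aff1 (\<Gamma> 2) [0, mono_elem t] = 0"
    by (rule B_series_eq_0[OF series, where es = "[- int (mono_xdeg t), int (mono_xdeg t)]"])
      (use t in \<open>simp_all add: xhom_0\<close>)
  show "B_series 2 aff1 (\<Gamma> 2) [mono_elem t, 0] = 0"
    by (rule B_series_eq_0[OF series, where es = "[int (mono_xdeg t), - int (mono_xdeg t)]"])
      (use t in \<open>simp_all add: xhom_0\<close>)
qed

lemma F_4_small:
  "sum_list (map mono_xdeg [a, b, c, e]) < 3 \<Longrightarrow>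
     F 4 [a, b, c, e] = 0"
  using F_small[of 4 "[a, b, c, e]"] by simp

lemma f_3_small:
  "sum_list (map mono_xdeg [a, b, c]) < 2 \<Longrightarrow>
     B_series 2 aff1 (\<Gamma> 3) [mono_elem a, mono_elem b, mono_elem c] = 0"
  using B_series_small[of 3 "[a, b, c]"] by (simp del: mono_elem.simps)

text \<open>The differential preserves the total degree 2 in the x_i, which is too small for f_4. In
  the products on the right f_3 only sees degree 1 and vanishes too, so a product of two scalars
  remains.\<close>

lemma equation_x0_p0_p1_x1:
  "F 3 [(1, True, False, Suc 0, 0), mono_p1, mono_x1] - F 3 [mono_x0, (1, True, True, 0, 0), mono_x1] +
     F 3 [mono_x0, mono_p0, (1, False, True, 0, Suc 0)] = F 2 [mono_x0, mono_p0] * F 2 [mono_p1, mono_x1]"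
proof -
  have "homogeneous_list (sext_grade 2) [0, 1, 1, 0]
      [mono_elem mono_x0, mono_elem mono_p0, mono_elem mono_p1, mono_elem mono_x1 :: 'k sext]"
    using mono_grades by (simp add: homogeneous_list_def del: mono_elem.simps)
  from arg_cong[OF morphism_eq[OF _ _ this, of 4], of const_part]
  show ?thesis
    unfolding const_part_ainf_lhs_4 const_part_ainf_rhs_4 const_part_ce_diff ce_diff_mono mono_elem_mult
    by (simp add: f2_scalars const_part_duflo_scalars const_part_mult_0 f_zero_arg F_4_small f_3_small mono_xdeg_def
        const_part_B_series_list del: mono_elem.simps)
qed

text \<open>The same degree count applies. The right-hand side agrees with that for (x_0, p^0, p^1,
  x_1), because f_2 takes the same value on (p^1, x_1) and (p^0, x_0).\<close>

lemma equation_x0_p0_p0_x0: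
  "F 3 [(1, True, False, Suc 0, 0), mono_p0, mono_x0] - F 3 [mono_x0, (0, True, False, 0, 0), mono_x0] +
     F 3 [mono_x0, mono_p0, (1, True, False, Suc 0, 0)] = F 2 [mono_x0, mono_p0] * F 2 [mono_p0, mono_x0]"
proof -
  have "homogeneous_list (sext_grade 2) [0, 1, 1, 0]
      [mono_elem mono_x0, mono_elem mono_p0, mono_elem mono_p0, mono_elem mono_x0 :: 'k sext]"
    using mono_grades by (simp add: homogeneous_list_def del: mono_elem.simps)
  from arg_cong[OF morphism_eq[OF _ _ this, of 4], of const_part]
  show ?thesis
    unfolding const_part_ainf_lhs_4 const_part_ainf_rhs_4 const_part_ce_diff ce_diff_mono mono_elem_mult
    by (simp add: f2_scalars const_part_duflo_scalars const_part_mult_0 f_zero_arg F_4_small f_3_small mono_xdeg_def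
        const_part_B_series_list del: mono_elem.simps)
qed

lemma inconsistent: False
proof -
  define P where "P = F 3 [(1, True, False, Suc 0, 0), mono_p0, mono_x0]"
  define Q where "Q = F 3 [mono_x0, mono_p0, (1, True, False, Suc 0, 0)]"
  define R where "R = F 3 [mono_x0, (1, True, True, 0, 0), mono_x1]"
  define S where "S = F 2 [mono_x0, mono_p0] * F 2 [mono_p0, mono_x0]"
  define U where "U = F 2 [(- 1, False, True, 0, Suc 0), mono_x0]"
  define V where "V = F 2 [mono_x0, (1, False, True, 0, Suc 0)]"
  have 1: "U - V = 1 / 24"
    using equation_x0_x0 unfolding F_relations U_def V_def by simp
  have 2: "- P - R - Q + U - V = 0"
    using equation_x0_p1_x1 unfolding F_relations P_def Q_def R_def U_def V_def by simp
  have 3: "- R = S"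
    using equation_x0_p0_p1_x1 unfolding F_relations R_def S_def by simp
  have 4: "P + Q = S"
    using equation_x0_p0_p0_x0 unfolding F_relations P_def Q_def S_def by simp
  \<comment> \<open>The third-order equation expresses the Duflo constant by f_3; the two
    fourth-order ones identify both \<open>P + Q\<close> and \<open>- R\<close> with the product
    \<open>S\<close>, which forces that constant to be 0.\<close>
  have "U - V = P + Q + R"
    using 2 by (simp add: algebra_simps)
  also have "\<dots> = 0"
    using 3 4 by (metis add.left_inverse minus_equation_iff)
  finally show False
    using 1 by simp
qed

end

theorem theorem1p15:
  "\<not> (\<exists>\<Gamma> :: nat \<Rightarrow> nat \<Rightarrow> (dgraph \<Rightarrow>\<^sub>0 'k::field_char_0) set.
        (\<forall>n\<ge>2. \<Gamma> n \<in> dgraph_series n (1 - int n)) \<and>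
        (\<forall>d (c :: nat \<Rightarrow> nat \<Rightarrow> nat \<Rightarrow> 'k). lie_structure d c \<longrightarrow>
           ainf_morphism
             sext_scale (sext_grade d) (strict_ainf (ce_diff d c) (sext_mult (*)))
             sext_scale (sext_grade d) (strict_ainf (ce_diff d c) (sext_mult (duflo_mult d c)))
             (\<lambda>n. if n = 1 then hd else B_series d c (\<Gamma> n))))"
proof
  assume "\<exists>\<Gamma> :: nat \<Rightarrow> nat \<Rightarrow> (dgraph \<Rightarrow>\<^sub>0 'k) set.
        (\<forall>n\<ge>2. \<Gamma> n \<in> dgraph_series n (1 - int n)) \<and>
        (\<forall>d (c :: nat \<Rightarrow> nat \<Rightarrow> nat \<Rightarrow> 'k). lie_structure d c \<longrightarrow>
           ainf_morphism
             sext_scale (sext_grade d) (strict_ainf (ce_diff d c) (sext_mult (*)))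
             sext_scale (sext_grade d) (strict_ainf (ce_diff d c) (sext_mult (duflo_mult d c)))
             (\<lambda>n. if n = 1 then hd else B_series d c (\<Gamma> n)))"
  \<comment> \<open>The hypothesis covers all Lie algebras; it is specialized to \<open>aff1\<close>
    in dimension 2.\<close>
  then obtain \<Gamma> :: "nat \<Rightarrow> nat \<Rightarrow> (dgraph \<Rightarrow>\<^sub>0 'k) set" where "universal_duflo_morphism \<Gamma>"
    unfolding universal_duflo_morphism_def using lie_structure_aff1 by blast
  then show False
    by (rule universal_duflo_morphism.inconsistent)
qed

end
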